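(* Given a graph $G$ with $n$ vertices and $m$ edges and an induced path $P_k$ on $k>2$ vertices of $G$, one can decide whether $P_k$ is avoidable in $O(n\cdot m)$ time.
   Context: All graphs are finite, simple and undirected. $P_k$ denotes an induced path on $k$ vertices; its endpoints are its two vertices of degree one and its internal path is the path obtained by removing the endpoints. An induced path $P_k$ ($k\ge2$) is simplicial if no induced path on $k+2$ vertices contains $P_k$ as its internal path, and avoidable if either it is simplicial or every induced path on $k+2$ vertices containing $P_k$ as its internal path is contained in an induced cycle. *)

theory Defs
  imports Main
begin

section \<open>Graphs, induced paths and cycles, avoidability\<close>

definition simple_graph :: "'a set \<Rightarrow> 'a set set \<Rightarrow> bool" where
  "simple_graph V E \<longleftrightarrow> finite V \<and> (\<forall>e\<in>E. e \<subseteq> V \<and> card e = 2)"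

text \<open>
  A path is listed from one endpoint to the other, so a list and its reverse denote the same path.
\<close>

definition induced_path :: "'a set \<Rightarrow> 'a set set \<Rightarrow> 'a list \<Rightarrow> bool" where
  "induced_path V E p \<longleftrightarrow>
     p \<noteq> [] \<and> distinct p \<and> set p \<subseteq> V \<and>
     (\<forall>i < length p. \<forall>j < length p.
        {p ! i, p ! j} \<in> E \<longleftrightarrow> j = Suc i \<or> i = Suc j)"

definition induced_cycle :: "'a set \<Rightarrow> 'a set set \<Rightarrow> 'a list \<Rightarrow> bool" where
  "induced_cycle V E c \<longleftrightarrow>
     3 \<le> length c \<and> distinct c \<and> set c \<subseteq> V \<and>
     (\<forall>i < length c. \<forall>j < length c.
        {c ! i, c ! j} \<in> E \<longleftrightarrow> j = Suc i mod length c \<or> i = Suc j mod length c)"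

definition internal_path :: "'a list \<Rightarrow> 'a list" where
  "internal_path q = butlast (tl q)"

definition extension :: "'a set \<Rightarrow> 'a set set \<Rightarrow> 'a list \<Rightarrow> 'a list \<Rightarrow> bool" where
  "extension V E p q \<longleftrightarrow>
     induced_path V E q \<and> length q = length p + 2 \<and>
     (internal_path q = p \<or> internal_path q = rev p)"

definition simplicial_path :: "'a set \<Rightarrow> 'a set set \<Rightarrow> 'a list \<Rightarrow> bool" where
  "simplicial_path V E p \<longleftrightarrow> \<not> (\<exists>q. extension V E p q)"

text \<open>
  Paths and cycles are induced subgraphs, so containment of one in another is inclusion of
  their vertex sets.
\<close>

definition avoidable_path :: "'a set \<Rightarrow> 'a set set \<Rightarrow> 'a list \<Rightarrow> bool" where
  "avoidable_path V E p \<longleftrightarrow>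
     simplicial_path V E p \<or>
     (\<forall>q. extension V E p q \<longrightarrow> (\<exists>c. induced_cycle V E c \<and> set q \<subseteq> set c))"

section \<open>Random access machines with unit-cost instructions\<close>

text \<open>
  A program refers to finitely many registers and finitely many arrays; interleaving the arrays
  turns this into a machine with a single memory at the cost of a constant factor.  The only
  arithmetic operations are successor and predecessor.  Hence in \<open>t\<close> steps no value exceeds the
  largest input value or program constant by more than \<open>t\<close>, so words of logarithmic length suffice
  for polynomial running times and charging one unit per instruction is legitimate.
\<close>

datatype instr =
    Const nat nat
  | Move nat nat
  | Inc nat
  | Dec nat
  | Load nat nat nat
  | Store nat nat nat
  | Jump nat
  | JumpEq nat nat nat
  | JumpLess nat nat nat

type_synonym program = "instr list"

text \<open>Program counter, registers, arrays.\<close>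

type_synonym config = "nat \<times> (nat \<Rightarrow> nat) \<times> (nat \<Rightarrow> nat \<Rightarrow> nat)"

fun exec :: "instr \<Rightarrow> config \<Rightarrow> config" where
  "exec (Const r c) (pc, R, A) = (Suc pc, R(r := c), A)"
| "exec (Move r s) (pc, R, A) = (Suc pc, R(r := R s), A)"
| "exec (Inc r) (pc, R, A) = (Suc pc, R(r := R r + 1), A)"
| "exec (Dec r) (pc, R, A) = (Suc pc, R(r := R r - 1), A)"
| "exec (Load r a i) (pc, R, A) = (Suc pc, R(r := A a (R i)), A)"
| "exec (Store a i r) (pc, R, A) = (Suc pc, R, A(a := (A a)(R i := R r)))"
| "exec (Jump l) (pc, R, A) = (l, R, A)"
| "exec (JumpEq r s l) (pc, R, A) = (if R r = R s then l else Suc pc, R, A)"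
| "exec (JumpLess r s l) (pc, R, A) = (if R r < R s then l else Suc pc, R, A)"

definition halted :: "program \<Rightarrow> config \<Rightarrow> bool" where
  "halted P s \<longleftrightarrow> length P \<le> fst s"

definition step :: "program \<Rightarrow> config \<Rightarrow> config" where
  "step P s = (if halted P s then s else exec (P ! fst s) s)"

text \<open>The answer of a halted machine is read off register 0: 1 for yes, 0 for no.\<close>

definition answers_in :: "program \<Rightarrow> config \<Rightarrow> nat \<Rightarrow> bool \<Rightarrow> bool" where
  "answers_in P s t b \<longleftrightarrow>
     (let s' = (step P ^^ t) s in halted P s' \<and> fst (snd s') 0 = (if b then 1 else 0))"

section \<open>Input encoding\<close>

definition adjacency_lists :: "nat \<Rightarrow> nat set set \<Rightarrow> (nat \<Rightarrow> nat list) \<Rightarrow> bool" where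
  "adjacency_lists n E adj \<longleftrightarrow>
     (\<forall>v < n. distinct (adj v) \<and> set (adj v) = {u. {v, u} \<in> E})"

definition list_array :: "nat list \<Rightarrow> nat \<Rightarrow> nat" where
  "list_array xs i = (if i < length xs then xs ! i else 0)"

text \<open>
  Registers 0 and 1 hold the number of vertices of the graph and of the path.  Array 1 holds the
  adjacency lists of the vertices \<open>0, \<dots>, n - 1\<close> one after the other; the list of \<open>v\<close> occupies
  the positions from entry \<open>v\<close> up to (excluding) entry \<open>v + 1\<close> of array 0.  Array 2 holds the path.
\<close>

definition input :: "nat \<Rightarrow> (nat \<Rightarrow> nat list) \<Rightarrow> nat list \<Rightarrow> config" where
  "input n adj p =
     (0,
      (\<lambda>_. 0)(0 := n, 1 := length p),
      (\<lambda>_ _. 0)(0 := list_array (map (\<lambda>v. \<Sum>u<v. length (adj u)) [0..<Suc n]),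
                1 := list_array (concat (map adj [0..<n])),
                2 := list_array p))"

end

theory Submission
  imports Defs
begin

text \<open>
  Let \<open>v\<close> and \<open>w\<close> be the endpoints of the path \<open>p\<close>, let \<open>X\<close> and \<open>Y\<close> be the sets of vertices whose
  only neighbour on \<open>p\<close> is \<open>v\<close> and \<open>w\<close>, respectively, and let \<open>W\<close> be the set of vertices without
  neighbours on \<open>p\<close>.  The extensions of \<open>p\<close> are the paths \<open>x p y\<close> with \<open>x \<in> X\<close>, \<open>y \<in> Y\<close> and
  \<open>x y\<close> not an edge, and such a path lies on an induced cycle iff \<open>y\<close> can be reached from \<open>x\<close>
  through \<open>W\<close>: an induced such connection closes the cycle.  As adjacent \<open>x\<close> and \<open>y\<close> reach each
  other trivially, \<open>p\<close> is avoidable iff every \<open>x \<in> X\<close> reaches every \<open>y \<in> Y\<close> through \<open>W\<close>.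
  One search per \<open>x\<close> costs \<open>O(n + m)\<close>, and the number of searches is at most the degree of \<open>v\<close>,
  hence at most \<open>min n m\<close>; this gives \<open>O(n m)\<close> even if \<open>m < n\<close>.
\<close>

section \<open>Induced cycles through an extension\<close>

lemma induced_path_rev: "induced_path V E (rev p) \<longleftrightarrow> induced_path V E p"
proof -
  have "induced_path V E (rev p)" if "induced_path V E p" for p
    unfolding induced_path_def
  proof (intro conjI allI impI)
    fix i j assume ij: "i < length (rev p)" "j < length (rev p)"
    define i' j' where "i' = length p - Suc i" and "j' = length p - Suc j"
    have "i' < length p" "j' < length p" "(j' = Suc i' \<or> i' = Suc j') \<longleftrightarrow> (j = Suc i \<or> i = Suc j)"
      using ij unfolding i'_def j'_def by auto
    then show "({rev p ! i, rev p ! j} \<in> E) = (j = Suc i \<or> i = Suc j)"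
      using that ij unfolding induced_path_def by (simp add: rev_nth i'_def j'_def)
  qed (use that in \<open>auto simp: induced_path_def\<close>)
  from this[of p] this[of "rev p"] show ?thesis by auto
qed

text \<open>Turns the condition on indices into one on vertices, so that paths can be grown vertex
  by vertex. The pair of \<open>z\<close> with itself is settled by the absence of loops.\<close>

lemma induced_path_append1:
  assumes "simple_graph V E" "p \<noteq> []"
  shows "induced_path V E (p @ [z]) \<longleftrightarrow>
    induced_path V E p \<and> z \<in> V \<and> z \<notin> set p \<and> (\<forall>u\<in>set p. {u, z} \<in> E \<longleftrightarrow> u = last p)"
    (is "?L \<longleftrightarrow> ?R")
proof
  assume L: ?L
  let ?n = "length p"
  have adj: "{(p @ [z]) ! i, (p @ [z]) ! j} \<in> E \<longleftrightarrow> j = Suc i \<or> i = Suc j"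
    if "i \<le> ?n" "j \<le> ?n" for i j
    using L that unfolding induced_path_def by auto
  have "induced_path V E p"
    unfolding induced_path_def
  proof (intro conjI allI impI)
    fix i j assume "i < ?n" "j < ?n"
    then show "({p ! i, p ! j} \<in> E) = (j = Suc i \<or> i = Suc j)"
      using adj[of i j] by (simp add: nth_append)
  qed (use L assms in \<open>auto simp: induced_path_def\<close>)
  moreover have "{u, z} \<in> E \<longleftrightarrow> u = last p" if u: "u \<in> set p" for u
  proof -
    obtain i where i: "i < ?n" "u = p ! i"
      using u by (auto simp: in_set_conv_nth)
    have "{u, z} \<in> E \<longleftrightarrow> ?n = Suc i"
      using adj[of i ?n] i by (auto simp: nth_append)
    also have "\<dots> \<longleftrightarrow> i = ?n - 1" using i by auto
    also have "\<dots> \<longleftrightarrow> u = last p"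
      using L i assms(2) by (auto simp: last_conv_nth induced_path_def nth_eq_iff_index_eq)
    finally show ?thesis .
  qed
  ultimately show ?R using L by (auto simp: induced_path_def)
next
  assume R: ?R
  let ?n = "length p"
  have z: "{p ! i, z} \<in> E \<longleftrightarrow> ?n = Suc i" if i: "i < ?n" for i
  proof -
    have "{p ! i, z} \<in> E \<longleftrightarrow> p ! i = p ! (?n - 1)"
      using R i assms(2) by (simp add: last_conv_nth)
    also have "\<dots> \<longleftrightarrow> i = ?n - 1"
      using R i by (subst nth_eq_iff_index_eq) (auto simp: induced_path_def)
    finally show ?thesis using i by auto
  qed
  have zz: "{z} \<notin> E" using assms(1) by (auto simp: simple_graph_def)
  show ?L
    unfolding induced_path_def
  proof (intro conjI allI impI)
    fix i j assume "i < length (p @ [z])" "j < length (p @ [z])"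
    then show "({(p @ [z]) ! i, (p @ [z]) ! j} \<in> E) = (j = Suc i \<or> i = Suc j)"
      using z[of i] z[of j] R zz
      by (auto simp: nth_append less_Suc_eq induced_path_def insert_commute)
  qed (use R in \<open>auto simp: induced_path_def\<close>)
qed

lemma induced_path_take:
  assumes "induced_path V E p" "0 < m"
  shows "induced_path V E (take m p)"
  using assms set_take_subset[of m p] unfolding induced_path_def by auto

text \<open>\<open>induced_path_append1\<close> is applied at the back and, through reversal, at the
  front. The conditions on \<open>x\<close> and \<open>y\<close> are the source of the sets
  \<open>X\<close> and \<open>Y\<close>.\<close>

lemma induced_path_Cons_append1:
  assumes "simple_graph V E" "p \<noteq> []"
  shows "induced_path V E (x # p @ [y]) \<longleftrightarrow>
    induced_path V E p \<and> x \<in> V \<and> y \<in> V \<and> x \<notin> set p \<and> y \<notin> set p \<and> x \<noteq> y \<and> {x, y} \<notin> E \<and>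
    (\<forall>u\<in>set p. {u, x} \<in> E \<longleftrightarrow> u = hd p) \<and> (\<forall>u\<in>set p. {u, y} \<in> E \<longleftrightarrow> u = last p)"
proof -
  have "induced_path V E (x # p @ [y]) \<longleftrightarrow> induced_path V E (rev (p @ [y]) @ [x])"
    using induced_path_rev[of V E "x # p @ [y]"] by simp
  also have "\<dots> \<longleftrightarrow> induced_path V E (p @ [y]) \<and> x \<in> V \<and> x \<notin> set (p @ [y]) \<and>
      (\<forall>u\<in>set (p @ [y]). {u, x} \<in> E \<longleftrightarrow> u = hd p)"
    using assms by (subst induced_path_append1) (auto simp: induced_path_rev last_rev hd_append simp del: rev_append)
  finally show ?thesis
    using assms by (auto simp: induced_path_append1 insert_commute)
qed

section \<open>Rotating, reversing and gluing induced cycles\<close>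

lemma induced_cycle_rev:
  assumes "induced_cycle V E c"
  shows "induced_cycle V E (rev c)"
  unfolding induced_cycle_def
proof (intro conjI allI impI)
  let ?n = "length c"
  fix i j assume ij: "i < length (rev c)" "j < length (rev c)"
  define i' j' where "i' = ?n - Suc i" and "j' = ?n - Suc j"
  have mods: "Suc a mod ?n = (if Suc a = ?n then 0 else Suc a)"
    "Suc (?n - Suc a) mod ?n = (if a = 0 then 0 else ?n - a)" if "a < ?n" for a
    using that by (auto simp: Suc_diff_Suc mod_Suc)
  have "i < ?n" "j < ?n" using ij by simp_all
  then have "(j' = Suc i' mod ?n \<or> i' = Suc j' mod ?n) \<longleftrightarrow> (j = Suc i mod ?n \<or> i = Suc j mod ?n)"
    unfolding i'_def j'_def mods[OF \<open>i < ?n\<close>] mods[OF \<open>j < ?n\<close>] by (auto split: if_splits)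
  moreover have "i' < ?n" "j' < ?n"
    using ij unfolding i'_def j'_def by auto
  ultimately show "({rev c ! i, rev c ! j} \<in> E) =
      (j = Suc i mod length (rev c) \<or> i = Suc j mod length (rev c))"
    using assms ij unfolding induced_cycle_def by (simp add: rev_nth i'_def j'_def)
qed (use assms in \<open>auto simp: induced_cycle_def\<close>)

lemma induced_cycle_rotate1:
  assumes "induced_cycle V E c"
  shows "induced_cycle V E (rotate1 c)"
  unfolding induced_cycle_def
proof (intro conjI allI impI)
  let ?n = "length c"
  fix i j assume ij: "i < length (rotate1 c)" "j < length (rotate1 c)"
  have nth: "rotate1 c ! i = c ! (Suc i mod ?n)" if "i < ?n" for i
    using nth_rotate[of i c 1] that by simp
  have "0 < ?n" using ij by auto
  then have "Suc i mod ?n < ?n" "Suc j mod ?n < ?n" by simp_all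
  moreover have "(Suc j mod ?n = Suc (Suc i mod ?n) mod ?n \<or> Suc i mod ?n = Suc (Suc j mod ?n) mod ?n)
      \<longleftrightarrow> (j = Suc i mod ?n \<or> i = Suc j mod ?n)"
    using ij assms unfolding induced_cycle_def by (auto simp: mod_Suc)
  ultimately show "({rotate1 c ! i, rotate1 c ! j} \<in> E) =
      (j = Suc i mod length (rotate1 c) \<or> i = Suc j mod length (rotate1 c))"
    using assms ij unfolding induced_cycle_def by (simp add: nth)
qed (use assms in \<open>auto simp: induced_cycle_def\<close>)

lemma induced_cycle_rotate: "induced_cycle V E c \<Longrightarrow> induced_cycle V E (rotate m c)"
  by (induction m) (auto simp: induced_cycle_rotate1)

text \<open>Once \<open>u\<close> is rotated to the front, its cyclic neighbours sit at position 1
  and at the last position; in the latter case the direction is reversed.\<close>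

lemma induced_cycle_start:
  assumes c: "induced_cycle V E c" and "u \<in> set c" "v \<in> set c" "{u, v} \<in> E"
  obtains c' where "induced_cycle V E c'" "set c' = set c" "c' ! 0 = u" "c' ! 1 = v"
proof -
  obtain m where m: "m < length c" "c ! m = u"
    using assms(2) by (auto simp: in_set_conv_nth)
  define d where "d = rotate m c"
  have d: "induced_cycle V E d" "set d = set c" "length d = length c"
    using induced_cycle_rotate[OF c] by (auto simp: d_def)
  have len: "3 \<le> length d" using d(1) by (simp add: induced_cycle_def)
  have d0: "d ! 0 = u"
    using m nth_rotate[of 0 c m] by (cases "c = []") (simp_all add: d_def)
  obtain j where j: "j < length d" "d ! j = v"
    using assms(3) d by (metis in_set_conv_nth)
  have "j = Suc 0 mod length d \<or> 0 = Suc j mod length d"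
    using d(1) j d0 assms(4) len unfolding induced_cycle_def
    by (metis One_nat_def le_trans less_le_trans zero_less_numeral)
  then consider "j = 1" | "j = length d - 1"
    using len j by (auto simp: mod_Suc split: if_splits)
  then show ?thesis
  proof cases
    case 1
    with that[OF d(1,2) d0] j show ?thesis by simp
  next
    case 2
    \<comment> \<open>\<open>rotate1\<close> sends \<open>u\<close> to the back, so the reversal
      lists \<open>u\<close> first and the former last vertex \<open>v\<close> second.\<close>
    let ?e = "rev (rotate1 d)"
    obtain y ys where y: "d = y # ys" "ys \<noteq> []" using len by (cases d; cases "tl d") auto
    have "?e ! 0 = u" using d0 y by simp
    moreover have "?e ! 1 = v" using j 2 y by (simp add: rev_nth)
    ultimately show ?thesis
      using that[of ?e] induced_cycle_rev induced_cycle_rotate1 d by fastforce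
  qed
qed

text \<open>Inside each list, cyclic and linear successors agree because the other list is nonempty;
  the two junctions are exactly the cyclic successor pairs between the lists.\<close>

lemma induced_cycle_append:
  assumes p: "induced_path V E p" and r: "induced_path V E r"
    and len: "2 \<le> length p" "2 \<le> length r" and disj: "set p \<inter> set r = {}"
    and adj: "\<And>i j. i < length p \<Longrightarrow> j < length r \<Longrightarrow>
      {p ! i, r ! j} \<in> E \<longleftrightarrow> (i = length p - 1 \<and> j = 0) \<or> (i = 0 \<and> j = length r - 1)"
  shows "induced_cycle V E (p @ r)"
  unfolding induced_cycle_def
proof (intro conjI allI impI)
  let ?k = "length p" and ?l = "length r"
  fix i j assume ij: "i < length (p @ r)" "j < length (p @ r)"
  have mods: "Suc i mod length (p @ r) = (if Suc i = length (p @ r) then 0 else Suc i)"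
    "Suc j mod length (p @ r) = (if Suc j = length (p @ r) then 0 else Suc j)"
    using ij by auto
  consider "i < ?k" "j < ?k" | "i < ?k" "\<not> j < ?k" | "\<not> i < ?k" "j < ?k" | "\<not> i < ?k" "\<not> j < ?k"
    by blast
  then show "({(p @ r) ! i, (p @ r) ! j} \<in> E) =
      (j = Suc i mod length (p @ r) \<or> i = Suc j mod length (p @ r))"
  proof cases
    case 1
    then have "{p ! i, p ! j} \<in> E \<longleftrightarrow> j = Suc i \<or> i = Suc j"
      using p by (simp add: induced_path_def)
    with 1 len show ?thesis unfolding mods by (auto simp: nth_append)
  next
    case 2
    have "{p ! i, r ! (j - ?k)} \<in> E \<longleftrightarrow> (i = ?k - 1 \<and> j - ?k = 0) \<or> (i = 0 \<and> j - ?k = ?l - 1)"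
      using adj[of i "j - ?k"] 2 ij by auto
    with 2 ij len show ?thesis unfolding mods by (auto simp: nth_append)
  next
    case 3
    have "{p ! j, r ! (i - ?k)} \<in> E \<longleftrightarrow> (j = ?k - 1 \<and> i - ?k = 0) \<or> (j = 0 \<and> i - ?k = ?l - 1)"
      using adj[of j "i - ?k"] 3 ij by auto
    with 3 ij len show ?thesis unfolding mods by (auto simp: nth_append insert_commute)
  next
    case 4
    have "{r ! (i - ?k), r ! (j - ?k)} \<in> E \<longleftrightarrow> j - ?k = Suc (i - ?k) \<or> i - ?k = Suc (j - ?k)"
      using r 4 ij by (simp add: induced_path_def)
    also have "\<dots> \<longleftrightarrow> j = Suc i \<or> i = Suc j"
      using 4 by (auto simp: not_less Suc_diff_le)
    also have "\<dots> \<longleftrightarrow> j = Suc i mod length (p @ r) \<or> i = Suc j mod length (p @ r)"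
      using mods 4 ij len by auto
    finally show ?thesis using 4 by (simp add: nth_append)
  qed
qed (use p r len disj in \<open>auto simp: induced_path_def\<close>)

text \<open>
  Only \<open>x\<close> and vertices of \<open>W\<close> are expanded: \<open>reach E W x\<close> consists of the ends of walks from \<open>x\<close>
  whose inner vertices are \<open>x\<close> or in \<open>W\<close>.
\<close>

inductive_set reach :: "'a set set \<Rightarrow> 'a set \<Rightarrow> 'a \<Rightarrow> 'a set"
  for E W x where
  start: "x \<in> reach E W x"
| step: "u \<in> reach E W x \<Longrightarrow> u = x \<or> u \<in> W \<Longrightarrow> {u, z} \<in> E \<Longrightarrow> z \<in> reach E W x"

text \<open>Induction on the walk: an induced path to the previous vertex is cut as soon as it meets
  or touches the new end.\<close>

lemma reach_induced_path:
  assumes G: "simple_graph V E" and x: "x \<in> V" and z: "z \<in> reach E W x"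
  shows "\<exists>r. induced_path V E r \<and> hd r = x \<and> last r = z \<and> set r \<subseteq> {x, z} \<union> W"
  using z
proof induction
  case start
  have "{x} \<notin> E" using G by (auto simp: simple_graph_def)
  then show ?case
    using x by (intro exI[of _ "[x]"]) (auto simp: induced_path_def)
next
  case (step u z)
  \<comment> \<open>The vertex \<open>u\<close> is expanded, hence is \<open>x\<close> or in
    \<open>W\<close>, and may become an inner vertex.\<close>
  then obtain r where r: "induced_path V E r" "hd r = x" "last r = u" "set r \<subseteq> {x} \<union> W"
    by blast
  have ne: "r \<noteq> []" using r by (simp add: induced_path_def)
  \<comment> \<open>Leave \<open>r\<close> at the first vertex that is equal or adjacent to \<open>z\<close>.\<close>
  define P where "P i \<longleftrightarrow> i < length r \<and> (r ! i = z \<or> {r ! i, z} \<in> E)" for i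
  have "P (length r - 1)"
    using r ne step.hyps by (simp add: P_def last_conv_nth)
  then have "P (LEAST i. P i)" by (rule LeastI)
  then obtain m where m: "P m" "\<And>i. i < m \<Longrightarrow> \<not> P i"
    using not_less_Least by blast
  let ?t = "take (Suc m) r"
  have "last ?t = r ! m"
    using m(1) by (simp add: P_def take_Suc_conv_app_nth)
  then have t: "induced_path V E ?t" "hd ?t = x" "last ?t = r ! m" "?t \<noteq> []" "set ?t \<subseteq> {x} \<union> W"
    using r ne induced_path_take[of V E r "Suc m"] set_take_subset[of "Suc m" r]
    by (auto simp: hd_take)
  show ?case
  proof (cases "r ! m = z")
    case True
    with t show ?thesis by (intro exI[of _ ?t]) auto
  next
    case False
    have E: "{r ! m, z} \<in> E" using m False by (auto simp: P_def)
    have *: "u \<noteq> z \<and> {u, z} \<notin> E" if u: "u \<in> set (take m r)" for u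
    proof -
      obtain i where "i < m" "i < length r" "u = r ! i"
        using u by (auto simp: in_set_conv_nth)
      with m(2)[of i] show ?thesis by (simp add: P_def)
    qed
    have "z \<in> V" using step.hyps G by (auto simp: simple_graph_def)
    moreover have "set ?t = insert (r ! m) (set (take m r))"
      using m(1) by (auto simp: P_def take_Suc_conv_app_nth)
    ultimately have "induced_path V E (?t @ [z])"
      using t * E False by (subst induced_path_append1[OF G]) auto
    with t show ?thesis
      by (intro exI[of _ "?t @ [z]"]) (auto simp: hd_append)
  qed
qed

section \<open>Extensions and the characterisation of avoidability by reachability\<close>

text \<open>Orients extensions along \<open>p\<close>: an extension around \<open>rev p\<close> is
  the reversal of one around \<open>p\<close>.\<close>

lemma extension_iff:
  "extension V E p q \<longleftrightarrow>
    (\<exists>x y. (q = x # p @ [y] \<or> q = y # rev p @ [x]) \<and> induced_path V E (x # p @ [y]))"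
proof
  assume q: "extension V E p q"
  then have "2 \<le> length q" by (simp add: extension_def)
  then obtain x r y where xy: "q = x # r @ [y]"
    by (cases q; cases "tl q" rule: rev_cases) auto
  then have "r = p \<or> r = rev p"
    using q by (auto simp: extension_def internal_path_def)
  then show "\<exists>x y. (q = x # p @ [y] \<or> q = y # rev p @ [x]) \<and> induced_path V E (x # p @ [y])"
  proof
    assume "r = rev p"
    moreover have "induced_path V E (rev q)"
      using q by (simp add: induced_path_rev extension_def)
    ultimately show ?thesis using xy by auto
  qed (use q xy in \<open>auto simp: extension_def\<close>)
next
  assume "\<exists>x y. (q = x # p @ [y] \<or> q = y # rev p @ [x]) \<and> induced_path V E (x # p @ [y])"
  then obtain x y where xy: "q = x # p @ [y] \<or> q = y # rev p @ [x]" "induced_path V E (x # p @ [y])"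
    by blast
  have "induced_path V E (y # rev p @ [x])"
    using xy(2) induced_path_rev[of V E "x # p @ [y]"] by simp
  with xy show "extension V E p q"
    by (auto simp: extension_def internal_path_def)
qed

text \<open>The set \<open>W\<close> of the outline. Elements outside the graph belong to it too,
  but no edge leads to them.\<close>

definition nonneighbours :: "'a set set \<Rightarrow> 'a list \<Rightarrow> 'a set" where
  "nonneighbours E p = {w. \<forall>u\<in>set p. {u, w} \<notin> E}"

text \<open>Every vertex of a path with at least two vertices has a neighbour on it.\<close>

lemma nonneighbours_disjoint:
  assumes "induced_path V E p" "2 \<le> length p"
  shows "nonneighbours E p \<inter> set p = {}"
proof -
  have False if w: "w \<in> nonneighbours E p" "w \<in> set p" for w
  proof -
    obtain i where i: "i < length p" "w = p ! i" using w by (auto simp: in_set_conv_nth)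
    define j where "j = (if i = 0 then 1 else i - 1)"
    have "j < length p" "j = Suc i \<or> i = Suc j" using i assms by (auto simp: j_def)
    then have "{p ! j, w} \<in> E" using assms(1) i unfolding induced_path_def by auto
    with \<open>j < length p\<close> w show False by (auto simp: nonneighbours_def)
  qed
  then show ?thesis by blast
qed

text \<open>An induced connection \<open>r\<close> from \<open>x\<close> to \<open>y\<close> through
  \<open>W\<close> closes the cycle: of its vertices only \<open>x\<close> and \<open>y\<close> see
  \<open>p\<close>, each at its own endpoint.\<close>

lemma reach_induced_cycle:
  assumes G: "simple_graph V E" and p: "2 \<le> length p" and q: "induced_path V E (x # p @ [y])"
    and y: "y \<in> reach E (nonneighbours E p) x"
  shows "\<exists>c. induced_cycle V E c \<and> set (x # p @ [y]) \<subseteq> set c"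
proof -
  have ne: "p \<noteq> []" using p by auto
  note q = q[unfolded induced_path_Cons_append1[OF G ne]]
  obtain r where r: "induced_path V E r" "hd r = x" "last r = y"
      "set r \<subseteq> {x, y} \<union> nonneighbours E p"
    using reach_induced_path[OF G _ y] q by auto
  have rne: "r \<noteq> []" using r by (simp add: induced_path_def)
  have len: "2 \<le> length r"
    using r rne q by (cases r; cases "tl r") auto
  \<comment> \<open>After \<open>last p\<close> comes \<open>y\<close>, whereas \<open>r\<close>
    starts at \<open>x\<close>; hence the reversal.\<close>
  have "induced_cycle V E (p @ rev r)"
  proof (rule induced_cycle_append)
    show "set p \<inter> set (rev r) = {}"
      using r q nonneighbours_disjoint[of V E p] p by auto
    fix i j assume ij: "i < length p" "j < length (rev r)"
    let ?u = "rev r ! j"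
    have r0: "rev r ! 0 = y" "rev r ! (length r - 1) = x"
      using r rne by (auto simp: rev_nth last_conv_nth hd_conv_nth)
    have dr: "distinct (rev r)" using r by (simp add: induced_path_def)
    have xj: "?u = x \<longleftrightarrow> j = length r - 1"
      using r0 dr ij len by (metis One_nat_def Suc_le_lessD diff_less length_greater_0_conv length_rev less_numeral_extra(1) nth_eq_iff_index_eq rne)
    have yj: "?u = y \<longleftrightarrow> j = 0"
      using r0 dr ij len by (metis length_greater_0_conv length_rev nth_eq_iff_index_eq rne)
    have dp: "distinct p" using q by (simp add: induced_path_def)
    have pi: "p ! i = hd p \<longleftrightarrow> i = 0" "p ! i = last p \<longleftrightarrow> i = length p - 1"
      using ij ne dp by (auto simp: hd_conv_nth last_conv_nth nth_eq_iff_index_eq)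
    have m: "p ! i \<in> set p" using ij by simp
    have "?u \<in> set (rev r)" using ij nth_mem by blast
    then have "?u \<in> {x, y} \<union> nonneighbours E p" using r by auto
    then consider "?u = x" | "?u = y" | "?u \<in> nonneighbours E p" "?u \<noteq> x" "?u \<noteq> y" by blast
    then show "({p ! i, ?u} \<in> E) = (i = length p - 1 \<and> j = 0 \<or> i = 0 \<and> j = length (rev r) - 1)"
    proof cases
      case 1
      then have "{p ! i, ?u} \<in> E \<longleftrightarrow> i = 0" using q m pi by simp
      then show ?thesis using 1 xj yj q by auto
    next
      case 2
      then have "{p ! i, ?u} \<in> E \<longleftrightarrow> i = length p - 1" using q m pi by simp
      then show ?thesis using 2 xj yj q by auto
    next
      case 3
      then have "{p ! i, ?u} \<notin> E" using m by (simp add: nonneighbours_def)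
      then show ?thesis using 3 xj yj by auto
    qed
  qed (use p len q r in \<open>auto simp: induced_path_rev\<close>)
  moreover have "x \<in> set r" "y \<in> set r" using r rne by auto
  ultimately show ?thesis by (intro exI[of _ "p @ rev r"]) auto
qed

text \<open>Traversed in the direction of \<open>p\<close>, the cycle starts with \<open>p\<close>
  and \<open>y\<close> and ends with \<open>x\<close>; the vertices between \<open>y\<close> and
  \<open>x\<close> have no cyclic neighbour on \<open>p\<close>, so they lie in
  \<open>W\<close>.\<close>

lemma induced_cycle_reach:
  assumes G: "simple_graph V E" and p: "2 \<le> length p" and q: "induced_path V E (x # p @ [y])"
    and c: "induced_cycle V E c" "set (x # p @ [y]) \<subseteq> set c"
  shows "y \<in> reach E (nonneighbours E p) x"
proof -
  have ne: "p \<noteq> []" using p by auto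
  note q' = q[unfolded induced_path_Cons_append1[OF G ne]]
  let ?k = "length p"
  have "{p ! 0, p ! 1} \<in> E" "p ! 0 \<in> set p" "p ! 1 \<in> set p"
    using q' p by (auto simp: induced_path_def)
  \<comment> \<open>The first edge of \<open>p\<close> fixes both the start and the
    direction.\<close>
  then obtain d where d: "induced_cycle V E d" "set d = set c" "d ! 0 = p ! 0" "d ! 1 = p ! 1"
    using induced_cycle_start[OF c(1), of "p ! 0" "p ! 1"] c(2) by auto
  let ?L = "length d"
  have L: "3 \<le> ?L" and dd: "distinct d" using d by (auto simp: induced_cycle_def)
  have adj: "{d ! i, d ! j} \<in> E \<longleftrightarrow> j = Suc i mod ?L \<or> i = Suc j mod ?L" if "i < ?L" "j < ?L" for i j
    using d that by (simp add: induced_cycle_def)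
  have pyE: "{(p @ [y]) ! i, (p @ [y]) ! Suc i} \<in> E" if "i < ?k" for i
  proof -
    have "\<forall>i<length (x # p @ [y]). \<forall>j<length (x # p @ [y]).
        {(x # p @ [y]) ! i, (x # p @ [y]) ! j} \<in> E \<longleftrightarrow> j = Suc i \<or> i = Suc j"
      using q unfolding induced_path_def by blast
    from this[rule_format, of "Suc i" "Suc (Suc i)"] that show ?thesis by simp
  qed
  have dpy: "distinct (p @ [y])" using q by (simp add: induced_path_def)
  have spy: "set (p @ [y]) \<subseteq> set d" using c d by auto
  have kL: "?k + 2 \<le> ?L"
  proof -
    have "card (set (x # p @ [y])) \<le> card (set d)" using c d by (intro card_mono) auto
    moreover have "distinct (x # p @ [y])" using q unfolding induced_path_def by blast
    ultimately show ?thesis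
      using distinct_card[of "x # p @ [y]"] distinct_card[OF dd] by simp
  qed
  have dp: "d ! i = (p @ [y]) ! i" if "i \<le> ?k" for i
    using that
  proof (induction i rule: less_induct)
    case (less i)
    consider "i = 0" | "i = 1" | j where "i = Suc (Suc j)" by (cases i; cases "i - 1") auto
    then show ?case
    proof cases
      case 3
      have IH: "d ! j = (p @ [y]) ! j" "d ! Suc j = (p @ [y]) ! Suc j"
        using less 3 by auto
      have "(p @ [y]) ! i \<in> set d" using spy less.prems nth_mem[of i "p @ [y]"] by auto
      then obtain m where m: "m < ?L" "d ! m = (p @ [y]) ! i" by (auto simp: in_set_conv_nth)
      have "{d ! Suc j, d ! m} \<in> E" using pyE[of "Suc j"] m IH 3 less.prems by simp
      \<comment> \<open>The vertex in question is a cyclic neighbour of \<open>d ! Suc j\<close>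
        and, by distinctness, not its predecessor \<open>d ! j\<close>; only the successor
        remains.\<close>
      moreover have "m \<noteq> j"
        using m IH 3 less.prems dpy by (auto simp: nth_eq_iff_index_eq simp del: distinct_append)
      ultimately have "m = i" using adj[of "Suc j" m] m 3 less.prems kL by (auto simp: mod_Suc split: if_splits)
      with m show ?thesis by simp
    qed (use d p in \<open>auto simp: nth_append\<close>)
  qed
  \<comment> \<open>\<open>x\<close> is adjacent to \<open>d ! 0\<close>, whose other cyclic
    neighbour \<open>d ! 1\<close> lies on \<open>p\<close>.\<close>
  have dx: "d ! (?L - 1) = x"
  proof -
    have "x \<in> set d" using c d by auto
    then obtain m where m: "m < ?L" "d ! m = x" by (auto simp: in_set_conv_nth)
    have "{p ! 0, x} \<in> E" using q' ne by (simp add: hd_conv_nth)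
    then have "{d ! 0, d ! m} \<in> E" using d m by simp
    moreover have "m \<noteq> 1" using m d q' p by auto
    moreover have "d \<noteq> []" using L by auto
    ultimately have "m = ?L - 1" using adj[of 0 m] m L
      by (cases "Suc m = ?L") auto
    with m show ?thesis by simp
  qed
  have W: "d ! i \<in> nonneighbours E p" if i: "?k < i" "i < ?L - 1" for i
    unfolding nonneighbours_def
  proof (intro CollectI ballI)
    fix u assume "u \<in> set p"
    then obtain j where j: "j < ?k" "u = p ! j" by (auto simp: in_set_conv_nth)
    then have "u = d ! j" using dp[of j] by (simp add: nth_append)
    then show "{u, d ! i} \<notin> E" using adj[of j i] i j kL by (auto simp: mod_Suc)
  qed
  \<comment> \<open>Walks backwards from \<open>x\<close> at the last position down to
    \<open>y\<close> at position \<open>?k\<close>.\<close>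
  have "d ! (?L - 1 - i) \<in> reach E (nonneighbours E p) x" if "i \<le> ?L - 1 - ?k" for i
    using that
  proof (induction i)
    case 0
    then show ?case using dx reach.start[of x] by simp
  next
    case (Suc i)
    let ?u = "d ! (?L - 1 - i)"
    have "?u \<in> reach E (nonneighbours E p) x" using Suc by simp
    moreover have "?u = x \<or> ?u \<in> nonneighbours E p"
      using dx W[of "?L - 1 - i"] Suc.prems by (cases i) auto
    moreover have "{?u, d ! (?L - 1 - Suc i)} \<in> E"
      using adj[of "?L - 1 - i" "?L - 1 - Suc i"] Suc.prems kL by (auto simp: mod_Suc)
    ultimately show ?case by (rule reach.step)
  qed
  from this[of "?L - 1 - ?k"] kL have "d ! ?k \<in> reach E (nonneighbours E p) x" by simp
  then show ?thesis using dp[of ?k] by simp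
qed

text \<open>For \<open>v\<close> an endpoint of \<open>p\<close> these are the sets \<open>X\<close>
  and \<open>Y\<close> of the outline.\<close>

definition private_neighbours :: "'a set set \<Rightarrow> 'a list \<Rightarrow> 'a \<Rightarrow> 'a set" where
  "private_neighbours E p v = {x. {v, x} \<in> E \<and> (\<forall>u\<in>set p. {u, x} \<in> E \<longrightarrow> u = v)}"

text \<open>
  Needs at least three vertices: the neighbour of an endpoint on the path then has a second
  neighbour there.  This is why the algorithm need not test membership in the path.
\<close>

lemma private_neighbours_disjoint:
  assumes p: "induced_path V E p" and len: "2 < length p" and v: "v = hd p \<or> v = last p"
  shows "private_neighbours E p v \<inter> set p = {}"
proof -
  have ne: "p \<noteq> []" using len by auto
  have False if x: "x \<in> private_neighbours E p v" "x \<in> set p" for x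
  proof -
    obtain i where i: "i < length p" "x = p ! i" using x by (auto simp: in_set_conv_nth)
    have dp: "distinct p" using p by (simp add: induced_path_def)
    obtain a where a: "a < length p" "v = p ! a" "a = 0 \<or> a = length p - 1"
      using that[of 0] that[of "length p - 1"] v ne by (auto simp: hd_conv_nth last_conv_nth)
    have "{p ! a, p ! i} \<in> E" using x a i by (simp add: private_neighbours_def)
    then have ai: "i = Suc a \<or> a = Suc i" using p a i by (simp add: induced_path_def)
    \<comment> \<open>\<open>x\<close> is next to an endpoint, and \<open>p ! b\<close> is its other
      neighbour on the path.\<close>
    define b where "b = (if a = 0 then 2 else a - 2)"
    have b: "b < length p" "b = Suc i \<or> i = Suc b" "b \<noteq> a"
      using a ai i len by (auto simp: b_def)
    then have "{p ! b, x} \<in> E" using p i by (auto simp: induced_path_def)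
    then have "p ! b = p ! a" using x a b by (auto simp: private_neighbours_def)
    with b a dp show False by (simp add: nth_eq_iff_index_eq)
  qed
  then show ?thesis by blast
qed

lemma avoidable_path_iff:
  assumes G: "simple_graph V E" and p: "induced_path V E p" and len: "2 < length p"
  shows "avoidable_path V E p \<longleftrightarrow>
    (\<forall>x \<in> private_neighbours E p (hd p). \<forall>y \<in> private_neighbours E p (last p).
       y \<in> reach E (nonneighbours E p) x)"
proof -
  let ?X = "private_neighbours E p (hd p)" and ?Y = "private_neighbours E p (last p)"
  have ne: "p \<noteq> []" using len by auto
  have "hd p \<noteq> last p"
    using p len ne by (auto simp: induced_path_def hd_conv_nth last_conv_nth nth_eq_iff_index_eq)
  then have neq: "x \<noteq> y" if "x \<in> ?X" "y \<in> ?Y" for x y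
    using that ne by (auto simp: private_neighbours_def)
  have ext: "induced_path V E (x # p @ [y]) \<longleftrightarrow> x \<in> ?X \<and> y \<in> ?Y \<and> {x, y} \<notin> E" for x y
  proof -
    have V: "v \<in> V" if "{u, v} \<in> E" for u v using that G by (auto simp: simple_graph_def)
    have "x \<notin> set p" if "x \<in> ?X" for x
      using private_neighbours_disjoint[OF p len, of "hd p"] that by auto
    moreover have "x \<notin> set p" if "x \<in> ?Y" for x
      using private_neighbours_disjoint[OF p len, of "last p"] that by auto
    moreover have "x \<in> private_neighbours E p v \<longleftrightarrow> x \<in> V \<and> (\<forall>u\<in>set p. {u, x} \<in> E \<longleftrightarrow> u = v)"
      if "v \<in> set p" for v x
      using that V[of v x] by (auto simp: private_neighbours_def)
    ultimately show ?thesis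
      using induced_path_Cons_append1[OF G ne, of x y] p ne neq hd_in_set[OF ne] last_in_set[OF ne]
      by blast
  qed
  have cyc: "(\<exists>c. induced_cycle V E c \<and> set (x # p @ [y]) \<subseteq> set c) \<longleftrightarrow>
      y \<in> reach E (nonneighbours E p) x" if "induced_path V E (x # p @ [y])" for x y
    using reach_induced_cycle[OF G _ that] induced_cycle_reach[OF G _ that] len by auto
  \<comment> \<open>The simplicial case is the vacuous one, and both orientations of an extension
    have the same vertices.\<close>
  have "avoidable_path V E p \<longleftrightarrow>
      (\<forall>x y. induced_path V E (x # p @ [y]) \<longrightarrow> (\<exists>c. induced_cycle V E c \<and> set (x # p @ [y]) \<subseteq> set c))"
    unfolding avoidable_path_def simplicial_path_def extension_iff by fastforce
  also have "\<dots> \<longleftrightarrow> (\<forall>x y. x \<in> ?X \<and> y \<in> ?Y \<and> {x, y} \<notin> E \<longrightarrow> y \<in> reach E (nonneighbours E p) x)"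
    using cyc ext by meson
  also have "\<dots> \<longleftrightarrow> (\<forall>x\<in>?X. \<forall>y\<in>?Y. y \<in> reach E (nonneighbours E p) x)"
  proof -
    have "y \<in> reach E (nonneighbours E p) x" if "{x, y} \<in> E" for x y
      using reach.step[OF reach.start _ that] by simp
    then show ?thesis by metis
  qed
  finally show ?thesis .
qed

section \<open>Structured programs with running times\<close>

type_synonym store = "(nat \<Rightarrow> nat) \<times> (nat \<Rightarrow> nat \<Rightarrow> nat)"

datatype com =
    Block "instr list"
  | Seq com com
  | IfEq nat nat com com
  | WhileLess nat nat com

text \<open>\<open>l\<close> is the address of the fragment, since jump targets are absolute. The
  else branch comes first and jumps over the then branch.\<close>

fun compile :: "com \<Rightarrow> nat \<Rightarrow> program" where
  "compile (Block is) l = is"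
| "compile (Seq c d) l = compile c l @ compile d (l + length (compile c l))"
| "compile (IfEq r r' c d) l =
     (let q = compile d (l + 1); m = l + length q + 2; p = compile c m
      in JumpEq r r' m # q @ Jump (m + length p) # p)"
| "compile (WhileLess r r' c) l =
     (let q = compile c (l + 2)
      in JumpLess r r' (l + 2) # Jump (l + length q + 3) # q @ [Jump l])"

fun straight :: "instr \<Rightarrow> bool" where
  "straight (Jump _) = False"
| "straight (JumpEq _ _ _) = False"
| "straight (JumpLess _ _ _) = False"
| "straight _ = True"

text \<open>The program counter 0 is arbitrary: instructions change the store independently of
  it.\<close>

definition effect :: "instr \<Rightarrow> store \<Rightarrow> store" where
  "effect i s = snd (exec i (0, s))"

lemma effect_simps [simp]:
  "effect (Const r c) (R, A) = (R(r := c), A)"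
  "effect (Move r r') (R, A) = (R(r := R r'), A)"
  "effect (Inc r) (R, A) = (R(r := Suc (R r)), A)"
  "effect (Dec r) (R, A) = (R(r := R r - 1), A)"
  "effect (Load r a i) (R, A) = (R(r := A a (R i)), A)"
  "effect (Store a i r) (R, A) = (R, A(a := (A a)(R i := R r)))"
  by (simp_all add: effect_def)

lemma exec_straight: "straight i \<Longrightarrow> exec i (l, s) = (Suc l, effect i s)"
  by (cases s; cases i) auto

text \<open>The times are those of the compiled code: an else branch pays for the test and the
  closing jump, a loop round for the test and the jump back, a loop exit for the test and the jump
  out.\<close>

inductive big_step :: "com \<Rightarrow> store \<Rightarrow> nat \<Rightarrow> store \<Rightarrow> bool" where
  Block: "list_all straight is \<Longrightarrow> big_step (Block is) s (length is) (fold effect is s)"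
| Seq: "big_step c s t s' \<Longrightarrow> big_step d s' t' s'' \<Longrightarrow> big_step (Seq c d) s (t + t') s''"
| IfTrue: "fst s r = fst s r' \<Longrightarrow> big_step c s t s' \<Longrightarrow> big_step (IfEq r r' c d) s (Suc t) s'"
| IfFalse: "fst s r \<noteq> fst s r' \<Longrightarrow> big_step d s t s' \<Longrightarrow> big_step (IfEq r r' c d) s (t + 2) s'"
| WhileFalse: "\<not> fst s r < fst s r' \<Longrightarrow> big_step (WhileLess r r' c) s 2 s"
| WhileTrue: "fst s r < fst s r' \<Longrightarrow> big_step c s t s' \<Longrightarrow> big_step (WhileLess r r' c) s' t' s'' \<Longrightarrow>
    big_step (WhileLess r r' c) s (t + t' + 2) s''"

fun code_at :: "program \<Rightarrow> nat \<Rightarrow> program \<Rightarrow> bool" where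
  "code_at P l [] = True"
| "code_at P l (i # is) = (l < length P \<and> P ! l = i \<and> code_at P (Suc l) is)"

lemma code_at_append [simp]:
  "code_at P l (xs @ ys) \<longleftrightarrow> code_at P l xs \<and> code_at P (l + length xs) ys"
  by (induction xs arbitrary: l) auto

lemma code_at_suffix: "code_at (xs @ ys) (length xs) ys"
proof (induction ys arbitrary: xs)
  case (Cons y ys)
  show ?case using Cons[of "xs @ [y]"] by simp
qed simp

definition steps :: "program \<Rightarrow> nat \<Rightarrow> config \<Rightarrow> config \<Rightarrow> bool" where
  "steps P t a b \<longleftrightarrow> (step P ^^ t) a = b"

lemma steps_trans: "steps P t a b \<Longrightarrow> steps P t' b c \<Longrightarrow> steps P (t + t') a c"
  unfolding steps_def by (subst add.commute) (simp add: funpow_add)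

lemma steps_0: "steps P 0 a a"
  by (simp add: steps_def)

lemma steps_1: "code_at P l [i] \<Longrightarrow> steps P 1 (l, s) (exec i (l, s))"
  by (simp add: steps_def step_def halted_def)

lemma steps_block:
  "list_all straight is \<Longrightarrow> code_at P l is \<Longrightarrow>
   steps P (length is) (l, s) (l + length is, fold effect is s)"
proof (induction "is" arbitrary: l s)
  case (Cons i "is")
  have "steps P 1 (l, s) (Suc l, effect i s)"
    using steps_1[of P l i s] Cons.prems by (simp add: exec_straight)
  moreover have "steps P (length is) (Suc l, effect i s) (Suc l + length is, fold effect is (effect i s))"
    using Cons.prems by (intro Cons.IH) auto
  ultimately show ?case
    using steps_trans by fastforce
qed (simp add: steps_0)

text \<open>Stated for any program \<open>P\<close> and address \<open>l\<close>, as subcommands are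
  compiled to fragments of a larger program.\<close>

lemma compile_correct:
  "big_step c s t s' \<Longrightarrow> code_at P l (compile c l) \<Longrightarrow>
   steps P t (l, s) (l + length (compile c l), s')"
proof (induction arbitrary: l rule: big_step.induct)
  case (Block "is" s)
  then show ?case by (simp add: steps_block)
next
  case (Seq c s t s' d t' s'')
  then show ?case
    by (auto simp: add.assoc[symmetric] intro: steps_trans)
next
  case (IfTrue s r r' c t s' d)
  let ?m = "l + length (compile d (l + 1)) + 2"
  have 1: "steps P 1 (l, s) (?m, s)"
    using steps_1[of P l "JumpEq r r' ?m" s] IfTrue by (cases s) (simp add: Let_def)
  have 2: "steps P t (?m, s) (?m + length (compile c ?m), s')"
    using IfTrue.prems by (intro IfTrue.IH) (simp add: Let_def)
  show ?case
    using steps_trans[OF 1 2] by (simp add: Let_def add.assoc)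
next
  case (IfFalse s r r' d t s' c)
  let ?q = "compile d (l + 1)"
  let ?m = "l + length ?q + 2"
  let ?e = "?m + length (compile c ?m)"
  have 1: "steps P 1 (l, s) (l + 1, s)"
    using steps_1[of P l "JumpEq r r' ?m" s] IfFalse by (cases s) (simp add: Let_def)
  have 2: "steps P t (l + 1, s) (l + 1 + length ?q, s')"
    using IfFalse.prems by (intro IfFalse.IH) (simp add: Let_def)
  have 3: "steps P 1 (l + 1 + length ?q, s') (?e, s')"
    using steps_1[of P "l + 1 + length ?q" "Jump ?e" s'] IfFalse.prems
    by (cases s') (simp add: Let_def)
  show ?case
    using steps_trans[OF steps_trans[OF 1 2] 3] by (simp add: Let_def add.assoc)
next
  case (WhileFalse s r r' c)
  let ?e = "l + length (compile c (l + 2)) + 3"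
  have 1: "steps P 1 (l, s) (l + 1, s)"
    using steps_1[of P l "JumpLess r r' (l + 2)" s] WhileFalse by (cases s) (simp add: Let_def)
  have 2: "steps P 1 (l + 1, s) (?e, s)"
    using steps_1[of P "l + 1" "Jump ?e" s] WhileFalse by (cases s) (simp add: Let_def)
  show ?case
    using steps_trans[OF 1 2] by (simp add: Let_def numeral_eq_Suc)
next
  case (WhileTrue s r r' c t s' t' s'')
  let ?q = "compile c (l + 2)"
  have 1: "steps P 1 (l, s) (l + 2, s)"
    using steps_1[of P l "JumpLess r r' (l + 2)" s] WhileTrue by (cases s) (simp add: Let_def)
  have 2: "steps P t (l + 2, s) (l + 2 + length ?q, s')"
    using WhileTrue.prems by (intro WhileTrue.IH(1)) (simp add: Let_def)
  have 3: "steps P 1 (l + 2 + length ?q, s') (l, s')"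
    using steps_1[of P "l + 2 + length ?q" "Jump l" s'] WhileTrue.prems
    by (cases s') (simp add: Let_def)
  have 4: "steps P t' (l, s') (l + length (compile (WhileLess r r' c) l), s'')"
    using WhileTrue.prems by (intro WhileTrue.IH(2))
  have "1 + t + 1 + t' = t + t' + 2" by simp
  with steps_trans[OF steps_trans[OF steps_trans[OF 1 2] 3] 4] show ?case by (simp only:)
qed

text \<open>
  \<open>B\<close> is a time budget: \<open>c\<close> terminates within it and leaves the unused part to \<open>Q\<close>, so loop
  invariants can carry amortised costs.
\<close>

definition runs :: "com \<Rightarrow> nat \<Rightarrow> store \<Rightarrow> (nat \<Rightarrow> store \<Rightarrow> bool) \<Rightarrow> bool" where
  "runs c B s Q \<longleftrightarrow> (\<exists>t s'. big_step c s t s' \<and> t \<le> B \<and> Q (B - t) s')"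

text \<open>The run ends just behind the last instruction, where the machine has halted.\<close>

lemma runs_answers_in:
  assumes "runs c B s (\<lambda>_ s'. fst s' 0 = (if b then 1 else 0))"
  shows "\<exists>t \<le> B. answers_in (compile c 0) (0, s) t b"
proof -
  obtain t s' where *: "big_step c s t s'" "t \<le> B" "fst s' 0 = (if b then 1 else 0)"
    using assms by (auto simp: runs_def)
  have "steps (compile c 0) t (0, s) (0 + length (compile c 0), s')"
    using * code_at_suffix[of "[]" "compile c 0"] by (intro compile_correct) auto
  then show ?thesis
    using * by (intro exI[of _ t]) (simp add: answers_in_def steps_def halted_def)
qed

lemma runs_mono:
  "runs c B s Q \<Longrightarrow> (\<And>B' s'. Q B' s' \<Longrightarrow> Q' B' s') \<Longrightarrow> runs c B s Q'"
  unfolding runs_def by blast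

lemma runs_Block:
  "list_all straight is \<Longrightarrow> length is \<le> B \<Longrightarrow> Q (B - length is) (fold effect is s) \<Longrightarrow>
   runs (Block is) B s Q"
  unfolding runs_def using big_step.Block by blast

lemma runs_Seq:
  assumes "runs c B s (\<lambda>B' s'. runs d B' s' Q)"
  shows "runs (Seq c d) B s Q"
proof -
  obtain t s' t' s'' where "big_step c s t s'" "t \<le> B" "big_step d s' t' s''" "t' \<le> B - t"
    "Q (B - t - t') s''"
    using assms unfolding runs_def by blast
  then show ?thesis
    unfolding runs_def by (intro exI[of _ "t + t'"] exI[of _ s'']) (auto intro: big_step.Seq)
qed

lemma runs_IfEq:
  assumes "2 \<le> B"
    and "fst s r = fst s r' \<Longrightarrow> runs c (B - 1) s Q"
    and "fst s r \<noteq> fst s r' \<Longrightarrow> runs d (B - 2) s Q"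
  shows "runs (IfEq r r' c d) B s Q"
proof (cases "fst s r = fst s r'")
  case True
  then obtain t s' where "big_step c s t s'" "t \<le> B - 1" "Q (B - 1 - t) s'"
    using assms unfolding runs_def by blast
  with True assms(1) show ?thesis
    unfolding runs_def by (intro exI[of _ "Suc t"] exI[of _ s']) (auto intro: big_step.IfTrue)
next
  case False
  then obtain t s' where "big_step d s t s'" "t \<le> B - 2" "Q (B - 2 - t) s'"
    using assms unfolding runs_def by blast
  with False assms(1) show ?thesis
    using big_step.IfFalse[of s r r' d t s' c] unfolding runs_def
    by (intro exI[of _ "t + 2"] exI[of _ s']) auto
qed

text \<open>The invariant refers to the remaining budget, and each round consumes at least two units
  of it; induction on the budget thus also yields termination.\<close>

lemma runs_WhileLess:
  assumes "I B s"
    and body: "\<And>B s. I B s \<Longrightarrow> fst s r < fst s r' \<Longrightarrow>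
      2 \<le> B \<and> runs c (B - 2) s I"
    and exit: "\<And>B s. I B s \<Longrightarrow> \<not> fst s r < fst s r' \<Longrightarrow> 2 \<le> B \<and> Q (B - 2) s"
  shows "runs (WhileLess r r' c) B s Q"
  using assms(1)
proof (induction B arbitrary: s rule: less_induct)
  case (less B)
  show ?case
  proof (cases "fst s r < fst s r'")
    case True
    then obtain t s' where 1: "2 \<le> B" "big_step c s t s'" "t \<le> B - 2" "I (B - 2 - t) s'"
      using body[OF less.prems] unfolding runs_def by blast
    then obtain t' s'' where "big_step (WhileLess r r' c) s' t' s''" "t' \<le> B - 2 - t"
      "Q (B - 2 - t - t') s''"
      using less.IH[of "B - 2 - t" s'] unfolding runs_def by fastforce
    with True 1 show ?thesis
      using big_step.WhileTrue[of s r r' c t s' t' s''] unfolding runs_def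
      by (intro exI[of _ "t + t' + 2"] exI[of _ s'']) (auto simp: algebra_simps)
  next
    case False
    with exit[OF less.prems] show ?thesis
      unfolding runs_def by (blast intro: big_step.WhileFalse)
  qed
qed

section \<open>Breadth-first search on the machine\<close>

text \<open>
  Breadth-first search from \<open>x\<close>: \<open>f\<close> is the stamp array, in which the entry \<open>s\<close> means visited; \<open>g\<close>
  is the queue, with \<open>t\<close> entries of which the first \<open>h\<close> have been expanded.
\<close>

definition search_inv ::
  "nat set set \<Rightarrow> nat set \<Rightarrow> nat \<Rightarrow> nat \<Rightarrow> nat \<Rightarrow> nat \<Rightarrow> (nat \<Rightarrow> nat) \<Rightarrow> (nat \<Rightarrow> nat) \<Rightarrow> bool" where
  "search_inv E W x s h t f g \<longleftrightarrow>
     h \<le> t \<and> inj_on g {..<t} \<and> g ` {..<t} = {u. f u = s \<and> (u = x \<or> u \<in> W)} \<and>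
     f x = s \<and> {u. f u = s} \<subseteq> reach E W x \<and>
     (\<forall>i<h. \<forall>z. {g i, z} \<in> E \<longrightarrow> f z = s) \<and> (\<forall>u. f u \<le> s)"

text \<open>All old stamps are below \<open>s\<close>, so nothing counts as visited. The bound
  \<open>f u \<le> s\<close> in the invariant makes the next stamp fresh again.\<close>

lemma search_inv_start:
  assumes "\<And>u. f u < s"
  shows "search_inv E W x s 0 1 (f(x := s)) (g(0 := x))"
proof -
  have "f u \<noteq> s" "f u \<le> s" for u using assms[of u] by auto
  then show ?thesis by (auto simp: search_inv_def lessThan_Suc intro: reach.start)
qed

lemma search_inv_queue:
  assumes "search_inv E W x s h t f g" "i < t"
  shows "g i \<in> reach E W x \<and> (g i = x \<or> g i \<in> W)"
proof -
  have "g i \<in> g ` {..<t}" using assms by simp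
  then have "f (g i) = s \<and> (g i = x \<or> g i \<in> W)"
    using assms(1) by (simp add: search_inv_def)
  then show ?thesis using assms(1) by (auto simp: search_inv_def)
qed

text \<open>A vertex outside \<open>W\<close> is stamped but not queued: walks may end there but not
  pass through it.\<close>

lemma search_inv_mark:
  assumes inv: "search_inv E W x s h t f g" and i: "i < t" "{g i, z} \<in> E"
    and z: "f z \<noteq> s" "z \<notin> W"
  shows "search_inv E W x s h t (f(z := s)) g"
proof -
  have "z \<in> reach E W x"
    using search_inv_queue[OF inv i(1)] i(2) reach.step[of "g i" E W x z] by simp
  moreover have "z \<noteq> x" using inv z by (auto simp: search_inv_def)
  ultimately show ?thesis using inv z unfolding search_inv_def by auto
qed

lemma search_inv_push:
  assumes inv: "search_inv E W x s h t f g" and i: "i < t" "{g i, z} \<in> E"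
    and z: "f z \<noteq> s" "z \<in> W"
  shows "search_inv E W x s h (Suc t) (f(z := s)) (g(t := z))"
proof -
  have r: "z \<in> reach E W x"
    using search_inv_queue[OF inv i(1)] i(2) reach.step[of "g i" E W x z] by simp
  have zg: "z \<notin> g ` {..<t}" using inv z by (auto simp: search_inv_def)
  have im: "(g(t := z)) ` {..<Suc t} = insert z (g ` {..<t})"
    by (auto simp: lessThan_Suc)
  \<comment> \<open>Only unstamped vertices are pushed, so none enters the queue twice; the time
    bound rests on this.\<close>
  have "inj_on (g(t := z)) {..<Suc t}"
    using inv zg by (auto simp: search_inv_def inj_on_def less_Suc_eq)
  moreover have "(g(t := z)) ` {..<Suc t} = {u. (f(z := s)) u = s \<and> (u = x \<or> u \<in> W)}"
    unfolding im using inv z by (auto simp: search_inv_def)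
  ultimately show ?thesis using inv z r unfolding search_inv_def by auto
qed

lemma search_inv_advance:
  assumes "search_inv E W x s h t f g" "h < t" "\<And>z. {g h, z} \<in> E \<Longrightarrow> f z = s"
  shows "search_inv E W x s (Suc h) t f g"
  using assms unfolding search_inv_def by (auto simp: less_Suc_eq)

text \<open>Once the queue is exhausted, the stamped set is closed under the rules of
  \<open>reach\<close>: every stamped vertex that may be expanded is in the queue and has been
  expanded.\<close>

lemma search_inv_finish:
  assumes inv: "search_inv E W x s t t f g"
  shows "{u. f u = s} = reach E W x"
proof
  show "reach E W x \<subseteq> {u. f u = s}"
  proof
    fix z assume "z \<in> reach E W x"
    then show "z \<in> {u. f u = s}"
    proof induction
      case (step u z)
      then have "u \<in> g ` {..<t}" using inv by (auto simp: search_inv_def)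
      then obtain i where "i < t" "u = g i" by auto
      with step.hyps inv show ?case by (simp add: search_inv_def)
    qed (use inv in \<open>simp add: search_inv_def\<close>)
  qed
qed (use inv in \<open>simp add: search_inv_def\<close>)

text \<open>
  Registers 8 and 9 hold the constants 0 and 1, registers 10 and 11 the endpoints of the path,
  register 14 the start of the current search and register 16 its stamp.  Array 3 counts the
  neighbours on the path, array 4 holds the stamps, array 5 the queue.
\<close>

definition for_adj :: "nat \<Rightarrow> nat \<Rightarrow> nat \<Rightarrow> nat \<Rightarrow> com \<Rightarrow> com" where
  "for_adj v j e z body =
     Seq (Block [Load j 0 v, Move e v, Inc e, Load e 0 e])
       (WhileLess j e (Seq (Block [Load z 1 j]) (Seq body (Block [Inc j]))))"

text \<open>Every path vertex adds one to the counters of its neighbours in array 3.\<close>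

definition count_neighbours :: com where
  "count_neighbours =
     WhileLess 2 1
       (Seq (Block [Load 3 2 2])
       (Seq (for_adj 3 4 5 6 (Block [Load 7 3 6, Inc 7, Store 3 6 7]))
            (Block [Inc 2])))"

text \<open>An unstamped vertex in register 22 is stamped, and queued if its counter is 0, that is,
  if it lies in \<open>W\<close>.\<close>

definition visit :: com where
  "visit =
     Seq (Block [Load 24 4 22])
       (IfEq 24 16 (Block [])
         (Seq (Block [Store 4 22 16, Load 24 3 22])
           (IfEq 24 8 (Block [Store 5 18 22, Inc 18]) (Block []))))"

text \<open>
  The stamp is the successor of the position of the start in the adjacency array.  It grows from
  search to search, so the stamp array never has to be cleared.
\<close>

definition search :: com where
  "search =
     Seq (Block [Move 16 12, Inc 16, Store 4 14 16, Store 5 8 14, Const 17 0, Const 18 1])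
       (WhileLess 17 18 (Seq (Block [Load 19 5 17, Inc 17]) (for_adj 19 20 21 22 visit)))"

text \<open>A neighbour of the last path vertex with counter 1, hence in \<open>Y\<close>, that
  lacks the current stamp makes the answer 0.\<close>

definition check_targets :: com where
  "check_targets =
     for_adj 11 20 21 22
       (Seq (Block [Load 24 3 22])
         (IfEq 24 9
           (Seq (Block [Load 24 4 22]) (IfEq 24 16 (Block []) (Block [Const 0 0])))
           (Block [])))"

text \<open>Register 1 still holds the path length, so its predecessor indexes the last path vertex.
  The answer starts as 1 and is only ever overwritten by 0.\<close>

definition avoidable_com :: com where
  "avoidable_com =
     Seq (Block [Const 9 1])
     (Seq count_neighbours
     (Seq (Block [Const 0 1, Load 10 2 8, Move 11 1, Dec 11, Load 11 2 11])
          (for_adj 10 12 13 14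
            (Seq (Block [Load 15 3 14])
              (IfEq 15 9 (Seq search check_targets) (Block []))))))"

section \<open>The encoded instance and the loop over an adjacency list\<close>

locale path_instance =
  fixes n :: nat and E :: "nat set set" and adj :: "nat \<Rightarrow> nat list" and p :: "nat list"
  assumes G: "simple_graph {..<n} E" and adj: "adjacency_lists n E adj"
    and path: "induced_path {..<n} E p" and len: "2 < length p"
begin

lemma edge_less: "{u, v} \<in> E \<Longrightarrow> u < n \<and> v < n"
  using G by (auto simp: simple_graph_def)

lemma set_adj: "v < n \<Longrightarrow> set (adj v) = {u. {v, u} \<in> E}"
  using adj by (simp add: adjacency_lists_def)

lemma distinct_adj: "v < n \<Longrightarrow> distinct (adj v)"
  using adj by (simp add: adjacency_lists_def)

lemma adj_less: "v < n \<Longrightarrow> u \<in> set (adj v) \<Longrightarrow> u < n"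
  using set_adj edge_less by auto

lemma path_less: "u \<in> set p \<Longrightarrow> u < n"
  using path by (auto simp: induced_path_def)

lemma path_nonempty: "p \<noteq> []"
  using len by auto

definition offset :: "nat \<Rightarrow> nat" where
  "offset v = (\<Sum>u<v. length (adj u))"

text \<open>The input part of the memory; it is invariant because the programs write only to arrays
  3, 4 and 5.\<close>

definition encoded :: "(nat \<Rightarrow> nat \<Rightarrow> nat) \<Rightarrow> bool" where
  "encoded A \<longleftrightarrow>
     A 0 = list_array (map offset [0..<Suc n]) \<and>
     A 1 = list_array (concat (map adj [0..<n])) \<and>
     A 2 = list_array p"

lemma encoded_update [simp]:
  "3 \<le> a \<Longrightarrow> encoded (A(a := f)) = encoded A"
  by (simp add: encoded_def)

lemma encoded_offset: "encoded A \<Longrightarrow> v \<le> n \<Longrightarrow> A 0 v = offset v"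
  by (simp add: encoded_def list_array_def nth_append del: upt_Suc)

lemma encoded_adj:
  assumes "encoded A" "v < n" "i < length (adj v)"
  shows "A (Suc 0) (offset v + i) = adj v ! i"
proof -
  have "[0..<n] = [0..<v] @ v # [Suc v..<n]"
    using assms(2) upt_add_eq_append[of 0 v "n - v"] upt_conv_Cons[of v n] by simp
  then have c: "concat (map adj [0..<n]) =
      concat (map adj [0..<v]) @ adj v @ concat (map adj [Suc v..<n])"
    by simp
  have "length (concat (map adj [0..<v])) = offset v"
    by (simp add: offset_def length_concat sum_list_sum_nth comp_def atLeast0LessThan)
  then show ?thesis
    using assms unfolding encoded_def One_nat_def c by (auto simp: list_array_def nth_append)
qed

lemma encoded_path: "encoded A \<Longrightarrow> i < length p \<Longrightarrow> A 2 i = p ! i"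
  by (simp add: encoded_def list_array_def)

text \<open>\<open>I i\<close> holds after \<open>i\<close> neighbours, \<open>T\<close> bounds the
  body, and \<open>K\<close> is reserved for what follows. Each round adds 4 for test, load,
  increment and jump back; the 6 pays for four setup instructions and the exit. \<open>frame\<close>
  keeps \<open>I\<close> independent of the loop registers.\<close>

lemma runs_for_adj:
  assumes A: "encoded A" and v: "R v < n" and regs: "distinct [v, j, e, z]"
    and B: "K + length (adj (R v)) * (T + 4) + 6 \<le> B"
    and init: "I 0 R A"
    and frame: "\<And>i R R' A. I i R A \<Longrightarrow> (\<And>r. r \<notin> {j, e, z} \<Longrightarrow> R' r = R r) \<Longrightarrow> I i R' A"
    and body: "\<And>i B K R' A'. T + K \<le> B \<Longrightarrow> i < length (adj (R v)) \<Longrightarrow> I i R' A' \<Longrightarrow> encoded A' \<Longrightarrow>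
      R' j = offset (R v) + i \<Longrightarrow> R' z = adj (R v) ! i \<Longrightarrow>
      runs body B (R', A') (\<lambda>B' s'. K \<le> B' \<and> I (Suc i) (fst s') (snd s') \<and> encoded (snd s') \<and>
        fst s' j = R' j \<and> fst s' e = R' e)"
    and exit: "\<And>B' R' A'. K \<le> B' \<Longrightarrow> I (length (adj (R v))) R' A' \<Longrightarrow> encoded A' \<Longrightarrow> Q B' (R', A')"
  shows "runs (for_adj v j e z body) B (R, A) Q"
proof -
  define w d where "w = R v" and "d = length (adj (R v))"
  note w = w_def[symmetric] and d = d_def[symmetric]
  have Sd: "offset (Suc w) = offset w + d" by (simp add: offset_def w_def d_def)
  define J where "J B s \<longleftrightarrow> (\<exists>i\<le>d. fst s j = offset w + i \<and> fst s e = offset w + d \<and>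
    encoded (snd s) \<and> I i (fst s) (snd s) \<and> K + (d - i) * (T + 4) + 2 \<le> B)" for B s
  show ?thesis
    unfolding for_adj_def
  proof (intro runs_Seq runs_Block)
    show "runs (WhileLess j e (Seq (Block [Load z 1 j]) (Seq body (Block [Inc j]))))
      (B - length [Load j 0 v, Move e v, Inc e, Load e 0 e])
      (fold effect [Load j 0 v, Move e v, Inc e, Load e 0 e] (R, A)) Q"
    proof (rule runs_WhileLess[where I = J])
      have "I 0 (R(j := offset w, e := offset w + d)) A"
        by (rule frame[OF init]) auto
      then show "J (B - length [Load j 0 v, Move e v, Inc e, Load e 0 e])
        (fold effect [Load j 0 v, Move e v, Inc e, Load e 0 e] (R, A))"
        using A v regs B Sd encoded_offset[OF A, of w] encoded_offset[OF A, of "Suc w"] w d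
        by (auto simp: J_def intro!: exI[of _ 0])
    next
      fix B s assume "J B s" and less: "fst s j < fst s e"
      then obtain i where i: "i \<le> d" "fst s j = offset w + i" "fst s e = offset w + d"
        "encoded (snd s)" "I i (fst s) (snd s)" "K + (d - i) * (T + 4) + 2 \<le> B"
        by (auto simp: J_def)
      obtain R' A' where s: "s = (R', A')" by (cases s)
      have id: "i < d" using less i by simp
      then obtain m where m: "d - i = Suc m" "d - Suc i = m" by (cases "d - i") auto
      have B: "T + (K + m * (T + 4) + 3) \<le> B - 3" "5 \<le> B" using i(6) m by auto
      have R'z: "A' (Suc 0) (R' j) = adj w ! i"
        using encoded_adj[of A' w i] i id s v w d by simp
      have I': "I i (R'(z := adj w ! i)) A'"
        by (rule frame[of i R']) (use i s in auto)
      \<comment> \<open>Test, jump back and load account for \<open>B - 3\<close>; the reserve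
        covers \<open>m\<close> further rounds, the exit and the increment.\<close>
      have "runs body (B - 3) (R'(z := adj w ! i), A') (\<lambda>B' s'. K + m * (T + 4) + 3 \<le> B' \<and>
          I (Suc i) (fst s') (snd s') \<and> encoded (snd s') \<and>
          fst s' j = (R'(z := adj w ! i)) j \<and> fst s' e = (R'(z := adj w ! i)) e)"
        using i s w d id regs I' B by (intro body[unfolded w d]) auto
      then have "runs (Seq body (Block [Inc j])) (B - 3) (R'(z := adj w ! i), A') J"
      proof (intro runs_Seq, elim runs_mono)
        fix B' s'
        assume *: "K + m * (T + 4) + 3 \<le> B' \<and>
          I (Suc i) (fst s') (snd s') \<and> encoded (snd s') \<and>
          fst s' j = (R'(z := adj w ! i)) j \<and> fst s' e = (R'(z := adj w ! i)) e"
        obtain R'' A'' where s': "s' = (R'', A'')" by (cases s')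
        have "I (Suc i) (R''(j := Suc (R'' j))) A''"
          by (rule frame[of _ R'']) (use * s' in auto)
        then show "runs (Block [Inc j]) B' s' J"
          using * s' regs i s id m by (intro runs_Block) (auto simp: J_def intro!: exI[of _ "Suc i"])
      qed
      then show "2 \<le> B \<and> runs (Seq (Block [Load z 1 j]) (Seq body (Block [Inc j]))) (B - 2) s J"
        using B R'z s by (auto intro!: runs_Seq[of "Block _"] runs_Block simp: numeral_eq_Suc)
    next
      fix B s assume "J B s" and "\<not> fst s j < fst s e"
      then have "K + 2 \<le> B" "encoded (snd s)" "I d (fst s) (snd s)"
        by (auto simp: J_def)
      then show "2 \<le> B \<and> Q (B - 2) s"
        using exit[unfolded d, of "B - 2" "fst s" "snd s"] by auto
    qed
  qed (use B in auto)
qed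

section \<open>Counting neighbours on the path\<close>

definition count :: "nat \<Rightarrow> nat \<Rightarrow> nat" where
  "count i u = length (filter (\<lambda>v. {v, u} \<in> E) (take i p))"

lemma count_0 [simp]: "count 0 u = 0"
  by (simp add: count_def)

lemma count_Suc: "i < length p \<Longrightarrow> count (Suc i) u = count i u + (if {p ! i, u} \<in> E then 1 else 0)"
  by (simp add: count_def take_Suc_conv_app_nth)

abbreviation total_count :: "nat \<Rightarrow> nat" where
  "total_count \<equiv> count (length p)"

lemma count_eq_0: "total_count u = 0 \<longleftrightarrow> u \<in> nonneighbours E p"
  by (auto simp: count_def nonneighbours_def filter_empty_conv)

text \<open>As \<open>p\<close> is distinct, the counter is a cardinality, and a singleton
  containing \<open>v\<close> is \<open>{v}\<close>.\<close>

lemma count_eq_1: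
  assumes "v \<in> set p" "{v, u} \<in> E"
  shows "total_count u = 1 \<longleftrightarrow> u \<in> private_neighbours E p v"
proof -
  let ?F = "{w \<in> set p. {w, u} \<in> E}"
  have "total_count u = card ?F"
    using path distinct_card[of "filter (\<lambda>v. {v, u} \<in> E) p"]
    by (simp add: count_def induced_path_def)
  also have "card ?F = 1 \<longleftrightarrow> ?F = {v}"
  proof
    assume "card ?F = 1"
    then obtain w where "?F = {w}" by (auto simp: card_1_singleton_iff)
    moreover have "v \<in> ?F" using assms by simp
    ultimately show "?F = {v}" by (metis singletonD)
  qed simp
  also have "\<dots> \<longleftrightarrow> u \<in> private_neighbours E p v"
    using assms by (auto simp: private_neighbours_def)
  finally show ?thesis .
qed

text \<open>The vertices of \<open>p\<close> are distinct, so no adjacency list is counted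
  twice.\<close>

lemma sum_degree_path: "(\<Sum>i<length p. length (adj (p ! i))) \<le> offset n"
proof -
  have "(\<Sum>i<length p. length (adj (p ! i))) = (\<Sum>v\<in>set p. length (adj v))"
    using path by (intro sum.reindex_bij_betw bij_betw_nth) (auto simp: induced_path_def)
  also have "\<dots> \<le> offset n"
    unfolding offset_def using path_less by (intro sum_mono2) auto
  finally show ?thesis .
qed

lemma runs_count_neighbours:
  assumes A: "encoded A" "A 3 = (\<lambda>_. 0)" and R: "R 1 = length p" "R 2 = 0"
    and B: "K + (10 * length p + 7 * offset n + 2) \<le> B"
    and Q: "\<And>B' R' A'. K \<le> B' \<Longrightarrow> \<forall>r. r = 1 \<or> 8 \<le> r \<longrightarrow> R' r = R r \<Longrightarrow>
      \<forall>a. a \<noteq> 3 \<longrightarrow> A' a = A a \<Longrightarrow> A' 3 = total_count \<Longrightarrow> Q B' (R', A')"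
  shows "runs count_neighbours B (R, A) Q"
proof -
  \<comment> \<open>Per path vertex: 2 for the loop, 1 for the load, 1 for the increment, and 6 plus
    \<open>3 + 4\<close> per neighbour for the scan.\<close>
  define c where "c i = 10 + 7 * length (adj (p ! i))" for i
  define J where "J B s \<longleftrightarrow> fst s 2 \<le> length p \<and>
    (\<forall>r. r = 1 \<or> 8 \<le> r \<longrightarrow> fst s r = R r) \<and> (\<forall>a. a \<noteq> 3 \<longrightarrow> snd s a = A a) \<and>
    snd s 3 = count (fst s 2) \<and> K + sum c {fst s 2..<length p} + 2 \<le> B" for B s
  have enc: "encoded A'" if "\<forall>a. a \<noteq> 3 \<longrightarrow> A' a = A a" for A'
    using A that by (auto simp: encoded_def)
  show ?thesis
    unfolding count_neighbours_def
  proof (rule runs_WhileLess[where I = J])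
    have "sum c {0..<length p} = 10 * length p + 7 * (\<Sum>i<length p. length (adj (p ! i)))"
      by (simp add: c_def sum.distrib sum_distrib_left atLeast0LessThan)
    then show "J B (R, A)"
      using A R B sum_degree_path by (auto simp: J_def)
  next
    fix B s assume J: "J B s" and less: "fst s 2 < fst s 1"
    obtain R1 A1 where s: "s = (R1, A1)" by (cases s)
    define i where "i = R1 2"
    have i: "i < length p" "R1 2 = i" using J less s R by (auto simp: J_def i_def)
    have fr: "\<forall>r. r = 1 \<or> 8 \<le> r \<longrightarrow> R1 r = R r" "\<forall>a. a \<noteq> 3 \<longrightarrow> A1 a = A a"
      "A1 3 = count i" "K + sum c {i..<length p} + 2 \<le> B"
      using J s i by (auto simp: J_def)
    have "sum c {i..<length p} = c i + sum c {Suc i..<length p}"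
      using i by (simp add: sum.atLeast_Suc_lessThan)
    then have B: "K + sum c {Suc i..<length p} + 2 + c i \<le> B" using fr by simp
    have w: "p ! i < n" using i path_less by simp
    let ?I = "\<lambda>m R' A'. R' 2 = i \<and> (\<forall>r. r = 1 \<or> 8 \<le> r \<longrightarrow> R' r = R r) \<and>
      (\<forall>a. a \<noteq> 3 \<longrightarrow> A' a = A a) \<and>
      (\<forall>u. A' 3 u = count i u + (if u \<in> set (take m (adj (p ! i))) then 1 else 0))"
    have "runs (for_adj 3 4 5 6 (Block [Load 7 3 6, Inc 7, Store 3 6 7])) (B - 3)
        (R1(3 := p ! i), A1) (\<lambda>B' s'. runs (Block [Inc 2]) B' s' J)"
    proof (rule runs_for_adj[where I = ?I and T = 3 and K = "K + sum c {Suc i..<length p} + 3"])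
      fix m B' K' :: nat and R' :: "nat \<Rightarrow> nat" and A' :: "nat \<Rightarrow> nat \<Rightarrow> nat"
      assume a: "3 + K' \<le> B'" "m < length (adj ((R1(3 := p ! i)) 3))" "?I m R' A'" "encoded A'"
        "R' 6 = adj ((R1(3 := p ! i)) 3) ! m"
      \<comment> \<open>Adjacency lists are distinct, so this counter has not yet been raised for
        \<open>p ! i\<close>.\<close>
      have "adj (p ! i) ! m \<notin> set (take m (adj (p ! i)))"
        using distinct_adj[OF w] a by (auto simp: in_set_conv_nth nth_eq_iff_index_eq)
      then show "runs (Block [Load 7 3 6, Inc 7, Store 3 6 7]) B' (R', A')
          (\<lambda>B' s'. K' \<le> B' \<and> ?I (Suc m) (fst s') (snd s') \<and> encoded (snd s') \<and>
            fst s' 4 = R' 4 \<and> fst s' 5 = R' 5)"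
        using a by (intro runs_Block) (auto simp: take_Suc_conv_app_nth)
    next
      fix B' R' A'
      assume a: "K + sum c {Suc i..<length p} + 3 \<le> B'"
        "?I (length (adj ((R1(3 := p ! i)) 3))) R' A'"
      have "A' 3 = count (Suc i)"
        using a i set_adj[OF w] by (auto simp: count_Suc)
      then show "runs (Block [Inc 2]) B' (R', A') J"
        using a i by (intro runs_Block) (auto simp: J_def)
    qed (use fr i w B enc[of A1] in \<open>auto simp: c_def\<close>)
    then show "2 \<le> B \<and> runs (Seq (Block [Load 3 2 2])
       (Seq (for_adj 3 4 5 6 (Block [Load 7 3 6, Inc 7, Store 3 6 7])) (Block [Inc 2]))) (B - 2) s J"
      using B s i encoded_path[of A1 i] enc[of A1] fr
      by (auto intro!: runs_Seq runs_Block simp: c_def numeral_3_eq_3)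
  next
    fix B s assume J: "J B s" and "\<not> fst s 2 < fst s 1"
    then have "fst s 2 = length p" using R by (auto simp: J_def)
    then show "2 \<le> B \<and> Q (B - 2) s"
      using J Q[of "B - 2" "fst s" "snd s"] by (auto simp: J_def)
  qed
qed

section \<open>Correctness and running time of one search\<close>

lemma reach_less: "x < n \<Longrightarrow> u \<in> reach E W x \<Longrightarrow> u < n"
  by (erule reach.cases) (auto dest: edge_less)

text \<open>Amortised: the budget holds a share for every vertex not yet expanded, and each vertex
  is expanded at most once.\<close>

lemma runs_search:
  assumes A: "encoded A" "A 3 = total_count" and R: "R 8 = 0" "R 14 < n"
    and fresh: "\<And>u. A 4 u \<le> R 12"
    and B: "K + (10 * n + 12 * offset n + 8) \<le> B"
    and Q: "\<And>B' R' A'. K \<le> B' \<Longrightarrow> \<forall>r<16. R' r = R r \<Longrightarrow> R' 16 = Suc (R 12) \<Longrightarrow>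
      \<forall>a. a \<noteq> 4 \<and> a \<noteq> 5 \<longrightarrow> A' a = A a \<Longrightarrow> \<forall>u. A' 4 u \<le> Suc (R 12) \<Longrightarrow>
      {u. A' 4 u = Suc (R 12)} = reach E (nonneighbours E p) (R 14) \<Longrightarrow> Q B' (R', A')"
  shows "runs search B (R, A) Q"
proof -
  define x S where "x = R 14" and "S = Suc (R 12)"
  let ?W = "nonneighbours E p"
  \<comment> \<open>Expanding \<open>u\<close> costs 2 for the loop, 2 for dequeuing, and 6 plus
    \<open>8 + 4\<close> per neighbour, where 8 is the cost of a \<open>visit\<close> that
    pushes.\<close>
  define c where "c u = 10 + 12 * length (adj u)" for u
  define frame where "frame R' A' \<longleftrightarrow> (\<forall>r<16. R' r = R r) \<and> R' 16 = S \<and>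
    (\<forall>a. a \<noteq> 4 \<and> a \<noteq> 5 \<longrightarrow> A' a = A a)" for R' A'
  have enc: "encoded A'" if "frame R' A'" for R' A'
    using A that by (auto simp: encoded_def frame_def)
  define J where "J B s \<longleftrightarrow> frame (fst s) (snd s) \<and>
    search_inv E ?W x S (fst s 17) (fst s 18) (snd s 4) (snd s 5) \<and>
    K + sum c ({..<n} - snd s 5 ` {..<fst s 17}) + 2 \<le> B" for B s
  show ?thesis
    unfolding search_def
  proof (intro runs_Seq runs_Block)
    let ?init = "[Move 16 12, Inc 16, Store 4 14 16, Store 5 8 14, Const 17 0, Const 18 1]"
    show "runs (WhileLess 17 18 (Seq (Block [Load 19 5 17, Inc 17]) (for_adj 19 20 21 22 visit)))
       (B - length ?init) (fold effect ?init (R, A)) Q"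
    proof (rule runs_WhileLess[where I = J])
      have "sum c {..<n} = 10 * n + 12 * offset n"
        by (simp add: c_def sum.distrib sum_distrib_left offset_def)
      moreover have "search_inv E ?W x S 0 1 ((A 4)(x := S)) ((A 5)(0 := x))"
        using fresh by (intro search_inv_start) (simp add: S_def le_imp_less_Suc)
      ultimately show "J (B - length ?init) (fold effect ?init (R, A))"
        using R B by (simp add: J_def frame_def x_def S_def)
    next
      fix B s assume J: "J B s" and less: "fst s 17 < fst s 18"
      obtain R1 A1 where s: "s = (R1, A1)" by (cases s)
      define h where "h = R1 17"
      define u where "u = A1 5 h"
      have h: "R1 17 = h" "h < R1 18" using less s by (simp_all add: h_def)
      have fr: "frame R1 A1" and inv: "search_inv E ?W x S h (R1 18) (A1 4) (A1 5)"
        and cost: "K + sum c ({..<n} - A1 5 ` {..<h}) + 2 \<le> B"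
        using J s h by (auto simp: J_def)
      have u: "u < n"
        using search_inv_queue[OF inv h(2)] reach_less R by (auto simp: x_def u_def)
      \<comment> \<open>By injectivity \<open>u\<close> was not expanded before, so its share is
        still available.\<close>
      have "inj_on (A1 5) {..<R1 18}" using inv by (simp add: search_inv_def)
      then have "u \<notin> A1 5 ` {..<h}"
        using h(2) unfolding u_def by (subst inj_on_image_mem_iff) auto
      then have "sum c ({..<n} - A1 5 ` {..<h}) = c u + sum c ({..<n} - A1 5 ` {..<h} - {u})"
        using u by (intro sum.remove) auto
      also have "{..<n} - A1 5 ` {..<h} - {u} = {..<n} - A1 5 ` {..<Suc h}"
        by (auto simp: lessThan_Suc u_def)
      finally have B: "K + sum c ({..<n} - A1 5 ` {..<Suc h}) + 2 + c u \<le> B" using cost by simp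
      \<comment> \<open>Register 17 is already advanced, but \<open>u\<close> counts as expanded
        only after its whole list is scanned. Pushes write behind position \<open>h\<close>, which
        preserves the expanded part of the queue.\<close>
      let ?I = "\<lambda>m R' A'. frame R' A' \<and> R' 17 = Suc h \<and> h < R' 18 \<and>
        (\<forall>i\<le>h. A' 5 i = A1 5 i) \<and>
        search_inv E ?W x S h (R' 18) (A' 4) (A' 5) \<and> (\<forall>z\<in>set (take m (adj u)). A' 4 z = S)"
      let ?R = "R1(19 := u, 17 := Suc h)"
      have "runs (for_adj 19 20 21 22 visit) (B - 4) (?R, A1) J"
      proof (rule runs_for_adj[where I = ?I and T = 8 and K = "K + sum c ({..<n} - A1 5 ` {..<Suc h}) + 2"])
        fix m B' K' :: nat and R' :: "nat \<Rightarrow> nat" and A' :: "nat \<Rightarrow> nat \<Rightarrow> nat"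
        assume a: "8 + K' \<le> B'" "m < length (adj (?R 19))" "?I m R' A'" "encoded A'"
          "R' 22 = adj (?R 19) ! m"
        let ?z = "adj u ! m"
        have z: "R' 22 = ?z" "m < length (adj u)" using a by simp_all
        have Ez: "{A' 5 h, ?z} \<in> E"
          using z set_adj[OF u] a by (auto simp: u_def dest: nth_mem)
        have fr': "R' 16 = S" "R' 8 = 0" "A' 3 = total_count" "h < R' 18"
          using a R A by (auto simp: frame_def)
        have inv': "search_inv E ?W x S h (R' 18) (A' 4) (A' 5)" using a by blast
        show "runs visit B' (R', A') (\<lambda>B' s'. K' \<le> B' \<and> ?I (Suc m) (fst s') (snd s') \<and>
            encoded (snd s') \<and> fst s' 20 = R' 20 \<and> fst s' 21 = R' 21)"
          unfolding visit_def
          using a z fr' search_inv_mark[OF inv' fr'(4) Ez] search_inv_push[OF inv' fr'(4) Ez]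
          by (intro runs_Seq runs_Block runs_IfEq)
            (auto simp: frame_def take_Suc_conv_app_nth count_eq_0)
      next
        fix B' R' A'
        assume a: "K + sum c ({..<n} - A1 5 ` {..<Suc h}) + 2 \<le> B'"
          "?I (length (adj (?R 19))) R' A'"
        have "search_inv E ?W x S (Suc h) (R' 18) (A' 4) (A' 5)"
          using a set_adj[OF u] by (intro search_inv_advance) (auto simp: u_def)
        moreover have "A' 5 ` {..<Suc h} = A1 5 ` {..<Suc h}"
          using a by (intro image_cong) auto
        ultimately show "J B' (R', A')"
          using a by (simp add: J_def)
      qed (use fr h inv u B enc[OF fr] in \<open>auto simp: c_def frame_def\<close>)
      then show "2 \<le> B \<and> runs (Seq (Block [Load 19 5 17, Inc 17]) (for_adj 19 20 21 22 visit)) (B - 2) s J"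
        using B s h
        by (auto intro!: runs_Seq[of "Block _"] runs_Block simp: c_def u_def)
    next
      fix B s assume J: "J B s" and "\<not> fst s 17 < fst s 18"
      then have "search_inv E ?W x S (fst s 18) (fst s 18) (snd s 4) (snd s 5)"
        by (auto simp: J_def search_inv_def)
      note search_inv_finish[OF this]
      moreover have "\<forall>u. snd s 4 u \<le> S" using J by (auto simp: J_def search_inv_def)
      ultimately show "2 \<le> B \<and> Q (B - 2) s"
        using J Q[of "B - 2" "fst s" "snd s"] by (auto simp: J_def frame_def x_def S_def)
    qed
  qed (use B in auto)
qed

lemma runs_check_targets:
  assumes A: "encoded A" "A 3 = total_count" and R: "R 9 = 1" "R 11 < n"
    and B: "K + (10 * length (adj (R 11)) + 6) \<le> B"
    and Q: "\<And>B' R'. K \<le> B' \<Longrightarrow> \<forall>r. 0 < r \<and> r < 16 \<longrightarrow> R' r = R r \<Longrightarrow>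
      R' 0 = (if \<forall>y\<in>set (adj (R 11)). total_count y = 1 \<longrightarrow> A 4 y = R 16 then R 0 else 0) \<Longrightarrow>
      Q B' (R', A)"
  shows "runs check_targets B (R, A) Q"
  unfolding check_targets_def
proof (rule runs_for_adj[where T = 6 and K = K and
      I = "\<lambda>m R' A'. A' = A \<and> (\<forall>r. 0 < r \<and> r \<le> 16 \<longrightarrow> R' r = R r) \<and>
        R' 0 = (if \<forall>y\<in>set (take m (adj (R 11))). total_count y = 1 \<longrightarrow> A 4 y = R 16 then R 0 else 0)"])
  let ?I = "\<lambda>m R' A'. A' = A \<and> (\<forall>r. 0 < r \<and> r \<le> 16 \<longrightarrow> R' r = R r) \<and>
        R' 0 = (if \<forall>y\<in>set (take m (adj (R 11))). total_count y = 1 \<longrightarrow> A 4 y = R 16 then R 0 else 0)"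
  fix m B' K' :: nat and R' :: "nat \<Rightarrow> nat" and A' :: "nat \<Rightarrow> nat \<Rightarrow> nat"
  assume a: "6 + K' \<le> B'" "m < length (adj (R 11))" "?I m R' A'" "encoded A'"
    "R' 22 = adj (R 11) ! m"
  have "R' 9 = 1" "R' 16 = R 16" "A' = A" using a R by auto
  then show "runs (Seq (Block [Load 24 3 22])
         (IfEq 24 9
           (Seq (Block [Load 24 4 22]) (IfEq 24 16 (Block []) (Block [Const 0 0])))
           (Block []))) B' (R', A')
      (\<lambda>B' s'. K' \<le> B' \<and> ?I (Suc m) (fst s') (snd s') \<and> encoded (snd s') \<and>
        fst s' 20 = R' 20 \<and> fst s' 21 = R' 21)"
    using a A
    by (intro runs_Seq runs_Block runs_IfEq) (auto simp: take_Suc_conv_app_nth)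
qed (use A R B Q in auto)

section \<open>The main loop\<close>

text \<open>The counting pass plus one search and one target check per neighbour of the first
  endpoint. The 14 is 1 and 5 for the two initial blocks, 2 for leaving the counting loop and 6 for
  the outer scan.\<close>

definition cost :: nat where
  "cost = 14 + 10 * length p + 7 * offset n +
     length (adj (hd p)) * (21 + 10 * n + 12 * offset n + 10 * length (adj (last p)))"

lemma runs_avoidable_com:
  assumes A: "encoded A" "A 3 = (\<lambda>_. 0)" "A 4 = (\<lambda>_. 0)"
    and R: "R 1 = length p" "R 2 = 0" "R 8 = 0"
  shows "runs avoidable_com cost (R, A)
    (\<lambda>_ s. fst s 0 = (if avoidable_path {..<n} E p then 1 else 0))"
proof -
  define v w where "v = hd p" and "w = last p"
  have vw: "v \<in> set p" "w \<in> set p" "v < n" "w < n"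
    using path_nonempty path_less by (auto simp: v_def w_def)
  define T where "T = 17 + 10 * n + 12 * offset n + 10 * length (adj w)"
  define good where "good x \<longleftrightarrow> (total_count x = 1 \<longrightarrow>
    (\<forall>y\<in>set (adj w). total_count y = 1 \<longrightarrow> y \<in> reach E (nonneighbours E p) x))" for x
  have av: "avoidable_path {..<n} E p \<longleftrightarrow> (\<forall>x\<in>set (adj v). good x)"
  proof -
    have "x \<in> private_neighbours E p u \<longleftrightarrow> x \<in> set (adj u) \<and> total_count x = 1"
      if "u \<in> set p" for u x
      using count_eq_1[OF that, of x] set_adj[of u] path_less[OF that]
      by (auto simp: private_neighbours_def)
    then show ?thesis
      unfolding avoidable_path_iff[OF G path len] good_def
      using vw by (auto simp: v_def w_def)
  qed
  have cost: "cost = 1 + ((5 + (length (adj v) * (T + 4) + 6)) + (10 * length p + 7 * offset n + 2))"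
    by (simp add: cost_def T_def v_def w_def add_mult_distrib2)
  define main where "main = Seq (Block [Load 15 3 14]) (IfEq 15 9 (Seq search check_targets) (Block []))"
  let ?Q = "\<lambda>(_::nat) (s::store). fst s 0 = (if avoidable_path {..<n} E p then 1 else 0)"
  have loop: "runs (for_adj 10 12 13 14 main) B (R1, A1) ?Q"
    if 1: "encoded A1" "A1 3 = total_count" "A1 4 = (\<lambda>_. 0)"
      "R1 0 = 1" "R1 8 = 0" "R1 9 = 1" "R1 10 = v" "R1 11 = w" "length (adj v) * (T + 4) + 6 \<le> B"
    for B R1 A1
  proof -
    \<comment> \<open>Stamps used so far are at most \<open>offset v + i\<close>, the value of
      register 12, so its successor is fresh for the next search.\<close>
    let ?I = "\<lambda>i R' A'. R' 0 = (if \<forall>x\<in>set (take i (adj v)). good x then 1 else 0) \<and>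
      R' 8 = 0 \<and> R' 9 = 1 \<and> R' 11 = w \<and> A' 3 = total_count \<and> (\<forall>u. A' 4 u \<le> offset v + i)"
    show ?thesis
    proof (rule runs_for_adj[where I = ?I and T = T and K = 0])
      fix i B' K' :: nat and R' :: "nat \<Rightarrow> nat" and A' :: "nat \<Rightarrow> nat \<Rightarrow> nat"
      assume a: "T + K' \<le> B'" "i < length (adj (R1 10))" "?I i R' A'" "encoded A'"
        "R' 12 = offset (R1 10) + i" "R' 14 = adj (R1 10) ! i"
      define x where "x = adj v ! i"
      have i: "i < length (adj v)" "R' 12 = offset v + i" "R' 14 = x"
        using a 1 by (simp_all add: x_def)
      have x: "x < n" using adj_less[OF vw(3)] i by (simp add: x_def)
      let ?P = "\<lambda>B' s'. K' \<le> B' \<and> ?I (Suc i) (fst s') (snd s') \<and> encoded (snd s') \<and>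
          fst s' 12 = R' 12 \<and> fst s' 13 = R' 13"
      have take: "set (take (Suc i) (adj v)) = insert x (set (take i (adj v)))"
        using i by (simp add: take_Suc_conv_app_nth x_def)
      have sc: "runs (Seq search check_targets) (B' - 2) (R'(15 := total_count x), A') ?P"
        if x1: "total_count x = 1"
      proof (intro runs_Seq runs_search[where K = "K' + (10 * length (adj w) + 6)"])
        fix B'' R'' A''
        assume b: "K' + (10 * length (adj w) + 6) \<le> B''"
          "\<forall>r<16. R'' r = (R'(15 := total_count x)) r"
          "R'' 16 = Suc ((R'(15 := total_count x)) 12)"
          "\<forall>a. a \<noteq> 4 \<and> a \<noteq> 5 \<longrightarrow> A'' a = A' a"
          "\<forall>u. A'' 4 u \<le> Suc ((R'(15 := total_count x)) 12)"
          "{u. A'' 4 u = Suc ((R'(15 := total_count x)) 12)} =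
             reach E (nonneighbours E p) ((R'(15 := total_count x)) 14)"
        have R'': "R'' 8 = 0" "R'' 9 = 1" "R'' 11 = w" "R'' 12 = R' 12" "R'' 13 = R' 13"
          "R'' 0 = R' 0" "R'' 16 = Suc (R' 12)"
          using b a by auto
        have enc: "encoded A''" using a b by (simp add: encoded_def)
        have reach: "A'' 4 u = Suc (R' 12) \<longleftrightarrow> u \<in> reach E (nonneighbours E p) x" for u
          using b(6) R'' i by auto
        show "runs check_targets B'' (R'', A'') ?P"
        proof (rule runs_check_targets[where K = K'])
          fix B3 R3
          assume c: "K' \<le> B3" "\<forall>r. 0 < r \<and> r < 16 \<longrightarrow> R3 r = R'' r"
            "R3 0 = (if \<forall>y\<in>set (adj (R'' 11)). total_count y = 1 \<longrightarrow> A'' 4 y = R'' 16 then R'' 0 else 0)"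
          have "R3 0 = (if good x then R' 0 else 0)"
            using c(3) R'' x1 by (auto simp: reach good_def)
          then have "R3 0 = (if \<forall>x\<in>set (take (Suc i) (adj v)). good x then 1 else 0)"
            using a(3) take by auto
          then show "?P B3 (R3, A'')"
            using c R'' enc a b i by auto
        qed (use enc a b R'' vw in auto)
      qed (use a i x vw in \<open>auto simp: T_def\<close>)
      have ne: "?P (B' - 3) (R'(15 := total_count x), A')" if "total_count x \<noteq> 1"
      proof -
        have "good x" using that by (simp add: good_def)
        then show ?thesis
          using a take by (auto simp: T_def le_Suc_eq)
      qed
      show "runs main B' (R', A') ?P"
        unfolding main_def
      proof (intro runs_Seq runs_Block)
        show "runs (IfEq 15 9 (Seq search check_targets) (Block [])) (B' - length [Load 15 3 14])
            (fold effect [Load 15 3 14] (R', A')) ?P"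
        proof (rule runs_IfEq)
          assume "fst (fold effect [Load 15 3 14] (R', A')) 15 = fst (fold effect [Load 15 3 14] (R', A')) 9"
          then have "total_count x = 1" using a i by simp
          then show "runs (Seq search check_targets) (B' - length [Load 15 3 14] - 1)
              (fold effect [Load 15 3 14] (R', A')) ?P"
            using sc a i by (simp add: numeral_2_eq_2)
        next
          assume "fst (fold effect [Load 15 3 14] (R', A')) 15 \<noteq> fst (fold effect [Load 15 3 14] (R', A')) 9"
          then have "total_count x \<noteq> 1" using a i by simp
          from ne[OF this] show "runs (Block []) (B' - length [Load 15 3 14] - 2)
              (fold effect [Load 15 3 14] (R', A')) ?P"
            using a i by (intro runs_Block) (simp_all add: numeral_3_eq_3)
        qed (use a in \<open>simp add: T_def\<close>)
      qed (use a in \<open>simp_all add: T_def\<close>)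
    next
      fix B' :: nat and R' :: "nat \<Rightarrow> nat" and A' :: "nat \<Rightarrow> nat \<Rightarrow> nat"
      assume "?I (length (adj (R1 10))) R' A'"
      then show "?Q B' (R', A')" using 1 av by simp
    qed (use 1 vw in auto)
  qed
  show ?thesis
    unfolding avoidable_com_def main_def[symmetric]
  proof (intro runs_Seq runs_Block)
    let ?K = "5 + (length (adj v) * (T + 4) + 6)"
    have "runs count_neighbours (cost - 1) (R(9 := 1), A)
      (\<lambda>B s. runs (Seq (Block [Const 0 1, Load 10 2 8, Move 11 1, Dec 11, Load 11 2 11])
        (for_adj 10 12 13 14 main)) B s ?Q)"
    proof (rule runs_count_neighbours[where K = ?K])
      fix B' R' A'
      assume b: "?K \<le> B'" "\<forall>r. r = 1 \<or> 8 \<le> r \<longrightarrow> R' r = (R(9 := 1)) r"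
        "\<forall>a. a \<noteq> 3 \<longrightarrow> A' a = A a" "A' 3 = total_count"
      have "p ! 0 = v" "p ! (length p - 1) = w"
        using path_nonempty by (simp_all add: v_def w_def hd_conv_nth last_conv_nth)
      moreover have "encoded A'" using A b by (simp add: encoded_def)
      ultimately show "runs (Seq (Block [Const 0 1, Load 10 2 8, Move 11 1, Dec 11, Load 11 2 11])
        (for_adj 10 12 13 14 main)) B' (R', A') ?Q"
        using b A R len path_nonempty encoded_path[of A' 0] encoded_path[of A' "length p - 1"]
        by (intro runs_Seq runs_Block loop[of "snd s" "fst s" for s, simplified]) auto
    qed (use A R cost in auto)
    then show "runs count_neighbours (cost - length [Const 9 1]) (fold effect [Const 9 1] (R, A))
      (\<lambda>B s. runs (Seq (Block [Const 0 1, Load 10 2 8, Move 11 1, Dec 11, Load 11 2 11])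
        (for_adj 10 12 13 14 main)) B s ?Q)"
      by simp
  qed (use cost in auto)
qed

section \<open>Bounding the cost by the product of order and size\<close>

lemma finite_edges: "finite E"
  using G finite_subset[of E "Pow {..<n}"] by (auto simp: simple_graph_def)

lemma degree_le_edges:
  assumes "v < n"
  shows "length (adj v) \<le> card E"
proof -
  have "length (adj v) = card {u. {v, u} \<in> E}"
    using distinct_card[OF distinct_adj] set_adj assms by metis
  also have "\<dots> \<le> card E"
    using finite_edges by (intro card_inj_on_le[of "\<lambda>u. {v, u}"]) (auto simp: inj_on_def doubleton_eq_iff)
  finally show ?thesis .
qed

lemma degree_le_order:
  assumes "v < n"
  shows "length (adj v) \<le> n"
proof -
  have "length (adj v) = card (set (adj v))"
    using distinct_card[OF distinct_adj] assms by metis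
  also have "\<dots> \<le> card {..<n}"
    using adj_less[OF assms] by (intro card_mono) auto
  finally show ?thesis by simp
qed

text \<open>Handshake argument: the ordered adjacent pairs split into increasing and decreasing
  ones, and each half injects into the edges.\<close>

lemma sum_degree_le: "offset n \<le> 2 * card E"
proof -
  let ?S = "\<lambda>P. {(v, u). {v, u} \<in> E \<and> P v u}"
  have half: "card (?S P) \<le> card E" if "\<And>u v. P u v \<Longrightarrow> \<not> P v u" for P
    using finite_edges that
    by (intro card_inj_on_le[of "\<lambda>(v, u). {v, u}"]) (auto simp: inj_on_def doubleton_eq_iff)
  have "offset n = (\<Sum>v<n. card (set (adj v)))"
    unfolding offset_def using distinct_card[OF distinct_adj] by (intro sum.cong) auto
  also have "\<dots> = card (SIGMA v:{..<n}. set (adj v))"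
    by (simp add: card_SigmaI)
  also have "(SIGMA v:{..<n}. set (adj v)) = ?S (<) \<union> ?S (>)"
  proof -
    have "{v} \<notin> E" for v using G by (auto simp: simple_graph_def)
    then have "v \<noteq> u" if "{v, u} \<in> E" for v u using that by auto
    then show ?thesis using set_adj edge_less by (fastforce simp: neq_iff)
  qed
  also have "card \<dots> \<le> card (?S (<)) + card (?S (>))"
    by (rule card_Un_le)
  also have "\<dots> \<le> 2 * card E"
    using half[of "(<)"] half[of "(>)"] by simp
  finally show ?thesis .
qed

text \<open>In the product of the degree with \<open>n\<close> and \<open>card E\<close>, the degree
  is bounded by \<open>card E\<close> against \<open>n\<close> and by \<open>n\<close> against
  \<open>card E\<close>. The path has an edge, so \<open>n * card E\<close> absorbs the lower terms;
  \<open>103 = 14 + 10 + 14 + 65\<close>.\<close>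

lemma cost_le: "cost \<le> 103 * (n * card E)"
proof -
  let ?m = "card E" and ?d = "length (adj (hd p))" and ?e = "length (adj (last p))"
  have v: "hd p < n" "last p < n" using path_nonempty path_less by auto
  have "{p ! 0, p ! 1} \<in> E" using path len by (simp add: induced_path_def)
  then have m: "1 \<le> ?m" using finite_edges by (auto simp: Suc_le_eq card_gt_0_iff)
  have n: "1 \<le> n" using v by simp
  have k: "length p \<le> n"
    using path distinct_card[of p] card_mono[of "{..<n}" "set p"] by (auto simp: induced_path_def)
  have off: "offset n \<le> 2 * ?m" by (rule sum_degree_le)
  have d: "?d \<le> ?m" "?d \<le> n" "?e \<le> ?m"
    using v degree_le_edges degree_le_order by auto
  have nm: "n \<le> n * ?m" "?m \<le> n * ?m" "1 \<le> n * ?m" using m n by auto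
  \<comment> \<open>\<open>34 = 12 * 2 + 10\<close>, from the degree sum and the degree of the last
    vertex.\<close>
  have "?d * (21 + 10 * n + 12 * offset n + 10 * ?e) \<le> ?d * (21 + 10 * n + 34 * ?m)"
    using off d by (intro mult_le_mono) auto
  also have "\<dots> = 21 * ?d + 10 * (?d * n) + 34 * (?d * ?m)"
    by (simp add: algebra_simps)
  also have "\<dots> \<le> 21 * (n * ?m) + 10 * (?m * n) + 34 * (n * ?m)"
    using d nm order_trans[OF d(1) nm(2)] by (intro add_mono mult_le_mono) auto
  also have "\<dots> = 65 * (n * ?m)" by simp
  finally show ?thesis
    using k off nm unfolding cost_def by linarith
qed

lemma answers_avoidable:
  "\<exists>t \<le> 103 * (n * card E).
    answers_in (compile avoidable_com 0) (input n adj p) t (avoidable_path {..<n} E p)"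
proof -
  obtain R A where RA: "input n adj p = (0, R, A)" "encoded A" "A 3 = (\<lambda>_. 0)" "A 4 = (\<lambda>_. 0)"
    "R 1 = length p" "R 2 = 0" "R 8 = 0"
    by (simp add: input_def encoded_def offset_def[abs_def] del: upt_Suc)
  from runs_answers_in[OF runs_avoidable_com[OF RA(2-)]] RA(1) cost_le show ?thesis
    by (auto intro: order_trans)
qed

end

theorem theorem33:
  "\<exists>(P :: program) (C :: nat). \<forall>(n :: nat) (E :: nat set set) (adj :: nat \<Rightarrow> nat list) (p :: nat list).
     simple_graph {..<n} E \<longrightarrow> adjacency_lists n E adj \<longrightarrow>
     induced_path {..<n} E p \<longrightarrow> 2 < length p \<longrightarrow>
     (\<exists>t \<le> C * (n * card E). answers_in P (input n adj p) t (avoidable_path {..<n} E p))"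
proof (rule exI, rule exI, intro allI impI)
  \<comment> \<open>The witnesses are still schematic and may not depend on the instance; the final
    \<open>show\<close> determines them.\<close>
  fix n E adj p
  assume "simple_graph {..<n} E" "adjacency_lists n E adj" "induced_path {..<n} E p" "2 < length p"
  then interpret path_instance n E adj p
    by unfold_locales
  show "\<exists>t \<le> 103 * (n * card E).
      answers_in (compile avoidable_com 0) (input n adj p) t (avoidable_path {..<n} E p)"
    by (rule answers_avoidable)
qed

end
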